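(* Let $q\ge5$ be odd. The map $$\hat\pi\colon I_{R_q}\setminus\partial\mathcal{J}(f_q^\star)\to\mathcal{A}_q^{\mathrm{dreg}}\setminus\big\{\underline{b}\in\mathcal{A}_q^{\mathrm{dreg}}:\ \underline{b}\text{ has the tail }\pm\underline{r}_q\big\}$$ defined by $\hat\pi(x)=\underline{b}=(b_i)_{i\in\mathbb{N}}$ if $(f_q^\star)^{i-1}(x)\in J^\star_{b_i}$ for all $i\in\mathbb{N}$, is bijective, and $\hat\pi\circ f_q^\star=\tau\circ\hat\pi$. Its inverse can be defined on the entire set $\mathcal{A}_q^{\mathrm{dreg}}$, as the map $\hat\pi^{-1}\colon\mathcal{A}_q^{\mathrm{dreg}}\to I_{R_q}$ given by $\hat\pi^{-1}(\underline{b})=[0;b_1,b_2,\dots]$.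
   Context: Let $q\ge5$ be odd, $\lambda_q=2\cos(\pi/q)$, $h_q=\frac{q-3}{2}$. Below $(a)^k$ denotes $a$ repeated $k$ times (absent if $k=0$), an overline marks a period, and $[0;b_1,b_2,\dots]$ denotes the limit as $n\to\infty$ of $\cfrac{-1}{b_1\lambda_q+\cfrac{-1}{b_2\lambda_q+\cdots+\cfrac{-1}{b_n\lambda_q}}}$. Let $r_q=[0;\overline{(1)^{h_q},2,(1)^{h_q-1},2}]$ and $R_q=\lambda_q+r_q$ (so $R_q>0$ and $R_q^2+(2-\lambda_q)R_q=1$), and $I_{R_q}=[-R_q,R_q]$. For $x\ge0$ let $\langle x\rangle_q^\star$ be the integer $n$ with $n\lambda_q+r_q\le x<n\lambda_q+R_q$, and for $x<0$ put $\langle x\rangle_q^\star=-\langle-x\rangle_q^\star$. The map $f_q^\star\colon I_{R_q}\to I_{R_q}$ is $f_q^\star(y)=-\frac1y-\langle-\frac1y\rangle_q^\star\,\lambda_q$ for $y\ne0$, $f_q^\star(0)=0$. Let $J_1^\star=\big[-R_q,\frac{-1}{r_q+2\lambda_q}\big]$, $J_m^\star=\big[\frac{-1}{r_q+m\lambda_q},\frac{-1}{r_q+(m+1)\lambda_q}\big]$ for $m\ge2$, and $J_{-m}^\star=-J_m^\star$ for $m\ge1$. Let $\partial\mathcal{J}(f_q^\star)=\{y\in I_{R_q}:\exists\,n\in\mathbb{Z}_{\ge0}\text{ with }(f_q^\star)^n(y)=\pm r_q\text{ or }(f_q^\star)^n(y)=0\}$. The forbidden blocks $\mathcal{B}_q$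 are $((\pm1)^{h_q+1})$ and $((\pm1)^{h_q},\pm2,(\pm1)^{h_q},\pm m)$, $m\ge1$ (same sign throughout each block). $\mathcal{A}_q^{\mathrm{dreg}}$ is the set of infinite sequences $(b_i)_{i\in\mathbb{N}}$ of nonzero integers which are dual $q$-regular: $(b_L,b_{L-1},\dots,b_l)\notin\mathcal{B}_q$ for all $1\le l<L$. $\tau$ is the shift $(\tau\underline{b})_i=b_{i+1}$. $\underline{r}_q=\overline{((1)^{h_q},2,(1)^{h_q-1},2)}$, $-\underline{r}_q$ is its negative, and $\underline{b}$ has the tail $\pm\underline{r}_q$ if $\tau^n(\underline{b})=\underline{r}_q$ or $\tau^n(\underline{b})=-\underline{r}_q$ for some $n\ge0$. *)

theory Defs
  imports Complex_Main
begin

text \<open>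
  All notions are parametrised by a natural number \<open>q\<close>, meant to be odd with \<open>q \<ge> 5\<close>.
  An infinite sequence of digits is a function \<open>b :: nat \<Rightarrow> int\<close> indexed from \<open>0\<close>, so
  \<open>b i\<close> is the mathematical digit \<open>b\<close> with index \<open>i + 1\<close>.
\<close>

definition rosen_lambda :: "nat \<Rightarrow> real" where
  "rosen_lambda q = 2 * cos (pi / real q)"

definition rosen_h :: "nat \<Rightarrow> nat" where
  "rosen_h q = (q - 3) div 2"

text \<open>The finite continued fraction \<open>-1/(b1 \<lambda> + -1/(b2 \<lambda> + \<dots> + -1/(bn \<lambda>)))\<close>.\<close>

fun rosen_cf_fin :: "nat \<Rightarrow> int list \<Rightarrow> real" where
  "rosen_cf_fin q [] = 0"
| "rosen_cf_fin q (b # bs) = -1 / (of_int b * rosen_lambda q + rosen_cf_fin q bs)"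

text \<open>No division by zero occurs in the finite continued fraction; this matters because
  \<open>x / 0 = 0\<close> in HOL.\<close>

fun rosen_cf_defined :: "nat \<Rightarrow> int list \<Rightarrow> bool" where
  "rosen_cf_defined q [] \<longleftrightarrow> True"
| "rosen_cf_defined q (b # bs) \<longleftrightarrow>
     rosen_cf_defined q bs \<and> of_int b * rosen_lambda q + rosen_cf_fin q bs \<noteq> 0"

definition seq_prefix :: "(nat \<Rightarrow> int) \<Rightarrow> nat \<Rightarrow> int list" where
  "seq_prefix b n = map b [0..<n]"

definition rosen_cf_converges :: "nat \<Rightarrow> (nat \<Rightarrow> int) \<Rightarrow> bool" where
  "rosen_cf_converges q b \<longleftrightarrow>
     (\<forall>n. rosen_cf_defined q (seq_prefix b n)) \<and>
     convergent (\<lambda>n. rosen_cf_fin q (seq_prefix b n))"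

definition rosen_cf :: "nat \<Rightarrow> (nat \<Rightarrow> int) \<Rightarrow> real" where
  "rosen_cf q b = lim (\<lambda>n. rosen_cf_fin q (seq_prefix b n))"

definition r_period :: "nat \<Rightarrow> int list" where
  "r_period q = replicate (rosen_h q) 1 @ [2] @ replicate (rosen_h q - 1) 1 @ [2]"

definition r_seq :: "nat \<Rightarrow> nat \<Rightarrow> int" where
  "r_seq q i = r_period q ! (i mod length (r_period q))"

definition r_val :: "nat \<Rightarrow> real" where
  "r_val q = rosen_cf q (r_seq q)"

definition R_val :: "nat \<Rightarrow> real" where
  "R_val q = rosen_lambda q + r_val q"

definition I_R :: "nat \<Rightarrow> real set" where
  "I_R q = {- R_val q .. R_val q}"

definition dual_nearest_nonneg :: "nat \<Rightarrow> real \<Rightarrow> int" where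
  "dual_nearest_nonneg q x =
     (THE n. of_int n * rosen_lambda q + r_val q \<le> x \<and>
             x < of_int n * rosen_lambda q + R_val q)"

definition dual_nearest :: "nat \<Rightarrow> real \<Rightarrow> int" where
  "dual_nearest q x =
     (if x \<ge> 0 then dual_nearest_nonneg q x else - dual_nearest_nonneg q (- x))"

definition dual_map :: "nat \<Rightarrow> real \<Rightarrow> real" where
  "dual_map q y =
     (if y = 0 then 0
      else - 1 / y - of_int (dual_nearest q (- 1 / y)) * rosen_lambda q)"

text \<open>The interval with positive index \<open>m\<close>, and then the intervals with arbitrary nonzero
  index; the index \<open>0\<close> is not used, and gets the empty set.\<close>

definition dual_J_pos :: "nat \<Rightarrow> int \<Rightarrow> real set" where
  "dual_J_pos q m =
     (if m = 1 then {- R_val q .. - 1 / (r_val q + 2 * rosen_lambda q)}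
      else {- 1 / (r_val q + of_int m * rosen_lambda q) ..
            - 1 / (r_val q + of_int (m + 1) * rosen_lambda q)})"

definition dual_J :: "nat \<Rightarrow> int \<Rightarrow> real set" where
  "dual_J q m =
     (if m > 0 then dual_J_pos q m
      else if m < 0 then uminus ` dual_J_pos q (- m)
      else {})"

definition dual_boundary :: "nat \<Rightarrow> real set" where
  "dual_boundary q =
     {y \<in> I_R q. \<exists>n. (dual_map q ^^ n) y = r_val q \<or> (dual_map q ^^ n) y = - r_val q \<or>
                     (dual_map q ^^ n) y = 0}"

definition forbidden_blocks :: "nat \<Rightarrow> int list set" where
  "forbidden_blocks q =
     {replicate (rosen_h q + 1) s | s. s \<in> {1, -1}} \<union>
     {replicate (rosen_h q) s @ [2 * s] @ replicate (rosen_h q) s @ [m * s] | s m.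
        s \<in> {1, -1} \<and> m \<ge> 1}"

definition dual_regular :: "nat \<Rightarrow> (nat \<Rightarrow> int) set" where
  "dual_regular q =
     {b. (\<forall>i. b i \<noteq> 0) \<and>
         (\<forall>l L. l < L \<longrightarrow> rev (map b [l..<Suc L]) \<notin> forbidden_blocks q)}"

definition seq_shift :: "(nat \<Rightarrow> int) \<Rightarrow> nat \<Rightarrow> int" where
  "seq_shift b = (\<lambda>i. b (Suc i))"

definition has_r_tail :: "nat \<Rightarrow> (nat \<Rightarrow> int) \<Rightarrow> bool" where
  "has_r_tail q b \<longleftrightarrow>
     (\<exists>n. (seq_shift ^^ n) b = r_seq q \<or> (seq_shift ^^ n) b = (\<lambda>i. - r_seq q i))"

definition is_coding :: "nat \<Rightarrow> real \<Rightarrow> (nat \<Rightarrow> int) \<Rightarrow> bool" where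
  "is_coding q x b \<longleftrightarrow> (\<forall>i. (dual_map q ^^ i) x \<in> dual_J q (b i))"

definition coding :: "nat \<Rightarrow> real \<Rightarrow> nat \<Rightarrow> int" where
  "coding q x = (THE b. is_coding q x b)"

end

theory Submission
  imports Defs
begin

text \<open>
  Write \<open>R\<close> for the positive root of \<open>R\<^sup>2 + (2 - \<lambda>) R = 1\<close>, \<open>r = R - \<lambda>\<close>, and
  \<open>mob c x = -1/(c \<lambda> + x)\<close>. The map \<open>G = mob 1\<close> is a rotation of order \<open>q = 2 h + 3\<close>, which gives
  \<open>G\<^bsup>h+1\<^esup> R = -R\<close> and \<open>r = G\<^sup>h (mob 2 (G\<^sup>h R))\<close>. Since all these maps are increasing, the first
  identity says that \<open>1\<^bsup>h+1\<^esup>\<close> would push a value below \<open>-R\<close>, and the second one that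
  \<open>1\<^sup>h, 2, 1\<^sup>h\<close> after a positive digit would push a value below \<open>r\<close>: regularity of a digit
  sequence is thus equivalent to its tails staying in \<open>[-R, R]\<close>, and in \<open>[r, R]\<close> after a positive
  digit. On \<open>[-R, R]\<close> the maps \<open>mob c\<close> contract by the factor \<open>R\<^sup>2 < 1\<close>, which gives convergence
  and uniqueness. The digits of a tail with value \<open>\<plusminus>r\<close> or \<open>\<plusminus>R\<close> are
  forced until they reach the digits of \<open>r\<close> or their negatives, so on the other sequences the
  intervals are never left through an endpoint and each digit is the one chosen by the dual map.
\<close>

section \<open>The constants \<open>lam\<close>, \<open>R\<close>, \<open>r\<close> and the maps
  \<open>mob\<close>\<close>

locale rosen_odd =
  fixes q :: nat
  assumes odd_q: "odd q" and q_ge_5: "q \<ge> 5"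
begin

abbreviation "lam \<equiv> rosen_lambda q"
abbreviation "h \<equiv> rosen_h q"

text \<open>\<open>R_val\<close> rests on the limit \<open>r_val\<close>, whose convergence is not
  yet established. The algebraic root stands in for it until \<open>R_val_eq\<close>.\<close>

definition R :: real where
  "R = (lam - 2 + sqrt ((lam - 2)\<^sup>2 + 4)) / 2"

definition r :: real where "r = R - lam"

definition mob :: "int \<Rightarrow> real \<Rightarrow> real" where
  "mob c x = - 1 / (of_int c * lam + x)"

abbreviation "G \<equiv> mob 1"

lemma q_eq: "q = 2 * h + 3"
  using odd_q q_ge_5 unfolding rosen_h_def by presburger

lemma h_pos: "1 \<le> h"
  using q_eq q_ge_5 by linarith

lemma lam_less_2: "lam < 2"
proof -
  have "cos (pi / real q) < cos 0"
    using q_ge_5 by (intro cos_monotone_0_pi) (auto simp: field_simps)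
  then show ?thesis by (simp add: rosen_lambda_def)
qed

lemma lam_ge_sqrt2: "sqrt 2 \<le> lam"
proof -
  have "cos (pi / 4) \<le> cos (pi / real q)"
    using q_ge_5 by (intro cos_monotone_0_pi_le) (auto simp: field_simps)
  then show ?thesis by (simp add: rosen_lambda_def cos_45)
qed

lemma lam_sq: "2 \<le> lam * lam"
proof -
  have "0 \<le> lam" using lam_ge_sqrt2 order_trans[of 0 "sqrt 2" lam] by simp
  then have "sqrt 2 * sqrt 2 \<le> lam * lam"
    using lam_ge_sqrt2 by (intro mult_mono) auto
  then show ?thesis by simp
qed

lemma lam_gt_1: "1 < lam"
proof -
  have "1 < sqrt (2 :: real)" by simp
  then show ?thesis using lam_ge_sqrt2 by linarith
qed

lemma R_eq: "R * R + (2 - lam) * R = 1"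
proof -
  have "sqrt ((lam - 2)\<^sup>2 + 4) * sqrt ((lam - 2)\<^sup>2 + 4) = (lam - 2)\<^sup>2 + 4"
    by (simp add: add_nonneg_nonneg)
  then show ?thesis unfolding R_def by (simp add: power2_eq_square field_simps)
qed

lemma R_pos: "0 < R"
proof -
  have "\<bar>lam - 2\<bar> < sqrt ((lam - 2)\<^sup>2 + 4)"
    by (rule real_less_rsqrt) simp
  then have "0 < lam - 2 + sqrt ((lam - 2)\<^sup>2 + 4)" by linarith
  then show ?thesis unfolding R_def by simp
qed

lemma R_less_1: "R < 1"
proof (rule ccontr)
  assume "\<not> R < 1"
  then have "1 * 1 \<le> R * R" by (intro mult_mono) auto
  moreover have "0 < (2 - lam) * R" using lam_less_2 R_pos by simp
  ultimately show False using R_eq by linarith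
qed

text \<open>The left side of \<open>R_eq\<close>, taken at \<open>lam / 2\<close> instead of
  \<open>R\<close>, equals \<open>1 - (1 - lam / 2)^2 < 1\<close>, and it increases on nonnegative
  arguments, so the root lies beyond \<open>lam / 2\<close>. In terms of \<open>r\<close> this is
  \<open>- R < r\<close>.\<close>

lemma lam_less_2R: "lam < 2 * R"
proof (rule ccontr)
  assume "\<not> lam < 2 * R"
  then have le: "R \<le> lam / 2" by simp
  have "R * R \<le> (lam / 2) * (lam / 2)" using le R_pos by (intro mult_mono) auto
  moreover have "(2 - lam) * R \<le> (2 - lam) * (lam / 2)"
    using le lam_less_2 by (intro mult_left_mono) auto
  moreover have "(lam / 2) * (lam / 2) + (2 - lam) * (lam / 2) = 1 - (1 - lam / 2) * (1 - lam / 2)"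
    by (simp add: field_simps)
  moreover have "0 < (1 - lam / 2) * (1 - lam / 2)" using lam_less_2 by simp
  ultimately show False using R_eq by linarith
qed

lemma r_bounds: "- R < r" "r < 0" "- 1 < r" "R < lam" "R = lam + r"
  using lam_less_2R R_less_1 lam_gt_1 unfolding r_def by linarith+

lemma inverse_R: "1 / R = 2 + r"
  using R_eq R_pos by (simp add: r_def field_simps)

text \<open>The sign symmetry that reduces statements on negative digits to positive ones.\<close>

lemma mob_minus: "mob (- c) (- x) = - mob c x"
proof -
  have "of_int (- c) * lam + - x = - (of_int c * lam + x)" by simp
  then show ?thesis unfolding mob_def by (metis divide_minus_right)
qed

lemma mob_mono: "0 < of_int c * lam + x \<Longrightarrow> x \<le> y \<Longrightarrow> mob c x \<le> mob c y"
  unfolding mob_def by (simp add: frac_le)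

lemma mob_less_cancel:
  "0 < of_int c * lam + x \<Longrightarrow> 0 < of_int c * lam + y \<Longrightarrow> mob c x < mob c y \<longleftrightarrow> x < y"
  unfolding mob_def by (simp add: divide_simps)

text \<open>Because \<open>2 * lam + r = lam + R\<close>, the digits 2 and 1 share a boundary value.
  This coincidence is the source of the two continuations in
  \<open>expansion_forced_boundary\<close>.\<close>

lemma mob_2_r: "mob 2 r = G R"
  unfolding mob_def using r_bounds(5) by (simp add: algebra_simps)

text \<open>After clearing the denominator the claim is
  \<open>1 < - r * (2 * lam + r) = lam^2 - R^2\<close>, where \<open>lam^2 \<ge> 2\<close> and
  \<open>R^2 < 1\<close>.\<close>

lemma r_le_mob_2_r: "r < mob 2 r"
proof -
  have "0 < (2 - lam) * R" using lam_less_2 R_pos by simp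
  then have "1 < lam * lam - R * R" using lam_sq R_eq by linarith
  then have "1 < - r * (2 * lam + r)" unfolding r_def by (simp add: algebra_simps)
  moreover have "0 < 2 * lam + r" using r_bounds lam_gt_1 by linarith
  ultimately show ?thesis unfolding mob_def
    by (simp add: divide_simps algebra_simps)
qed

text \<open>The matrix of \<open>x \<mapsto> -1/(\<lambda> + x)\<close> is a rotation by \<open>\<pi>/q\<close>, so its powers have
  entries proportional to \<open>sin (j \<pi> / q)\<close>.\<close>

definition s :: "real \<Rightarrow> real" where "s t = sin (t * (pi / real q))"

lemma s_rec: "s (t + 1) = lam * s t - s (t - 1)"
proof -
  define b where "b = pi / real q"
  have "(t + 1) * b = t * b + b" "(t - 1) * b = t * b - b" by (simp_all add: algebra_simps)
  then show ?thesis unfolding s_def rosen_lambda_def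
    by (simp add: sin_add sin_diff flip: b_def)
qed

lemma s_refl: "s (real q - t) = s t"
proof -
  have "(real q - t) * (pi / real q) = pi - t * (pi / real q)"
    using q_ge_5 by (simp add: field_simps)
  then show ?thesis by (simp add: s_def)
qed

text \<open>The two middle indices add up to \<open>q = 2 * h + 3\<close>, so the reflection
  exchanges them.\<close>

lemma s_mid: "s (real h + 2) = s (real h + 1)"
proof -
  have "real q - (real h + 1) = real h + 2" using q_eq by linarith
  then show ?thesis using s_refl[of "real h + 1"] by simp
qed

lemma s_pos: "0 < t \<Longrightarrow> t < real q \<Longrightarrow> 0 < s t"
  unfolding s_def using q_ge_5 by (intro sin_gt_zero) (auto simp: field_simps)

text \<open>For \<open>j \<le> h\<close> both angles lie below \<open>pi / 2\<close>, where the sine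
  increases; the last step \<open>j = h + 1\<close> is the equality \<open>s_mid\<close>.\<close>

lemma s_step:
  assumes "j \<le> h + 1"
  shows "s (real j) \<le> s (real j + 1)"
proof (cases "j = h + 1")
  case True
  then show ?thesis using s_mid by (simp add: add.commute)
next
  case False
  have q: "real q = 2 * real h + 3" using q_eq by simp
  have "pi * (2 * real j) \<le> pi * (1 + 2 * real h)"
    using assms False by (intro mult_left_mono) auto
  then have "(real j + 1) * (pi / real q) \<le> pi / 2"
    using q_ge_5 q by (simp add: field_simps)
  then show ?thesis unfolding s_def
    using q_ge_5 by (intro sin_monotone_2pi_le) (auto intro: order_trans[of _ 0] simp: field_simps)
qed

text \<open>Written as \<open>s j * (x + 1) + (s (j + 1) - s j)\<close>, both summands are
  nonnegative. This is the denominator of \<open>(G ^^ j) x\<close>, so no pole is met while up to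
  \<open>h + 1\<close> digits 1 are put in front of a value above -1.\<close>

lemma s_denom_pos:
  assumes "- 1 < x" "j \<le> h + 1"
  shows "0 < s (real j) * x + s (real j + 1)"
proof (cases "j = 0")
  case True
  then show ?thesis using s_pos[of 1] q_ge_5 by (simp add: s_def[of 0])
next
  case False
  have "real j < real q" using assms q_eq by linarith
  then have "0 < s (real j)" using s_pos False by simp
  then have "0 < s (real j) * (x + 1)" using assms by simp
  then show ?thesis using s_step[OF assms(2)] by (simp add: algebra_simps)
qed

text \<open>The closed form of the iterate is a hypothesis so that the lemma serves inside the
  induction of \<open>G_iter\<close> as well as after it.\<close>

lemma G_denom:
  assumes "- 1 < x" "j \<le> h + 1"
    and "(G ^^ j) x = - (s (real j - 1) * x + s (real j)) / (s (real j) * x + s (real j + 1))"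
  shows "lam + (G ^^ j) x =
    (s (real j + 1) * x + s (real j + 2)) / (s (real j) * x + s (real j + 1))"
proof -
  define D where "D = s (real j) * x + s (real j + 1)"
  have e: "s (real j + 1) = lam * s (real j) - s (real j - 1)"
    "s (real j + 2) = lam * s (real j + 1) - s (real j)"
    using s_rec[of "real j"] s_rec[of "real j + 1"] by (simp_all add: algebra_simps)
  have "0 < D" using s_denom_pos[OF assms(1,2)] by (simp add: D_def)
  then have "lam + (G ^^ j) x = (lam * D - (s (real j - 1) * x + s (real j))) / D"
    unfolding assms(3) D_def[symmetric] by (simp add: field_simps)
  also have "lam * D - (s (real j - 1) * x + s (real j)) =
      (lam * s (real j) - s (real j - 1)) * x + (lam * s (real j + 1) - s (real j))"
    by (simp add: D_def algebra_simps)
  finally show ?thesis by (simp only: e[symmetric] D_def)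
qed

lemma G_iter:
  assumes "- 1 < x" "j \<le> h + 1"
  shows "(G ^^ j) x = - (s (real j - 1) * x + s (real j)) / (s (real j) * x + s (real j + 1))"
  using assms(2)
proof (induction j)
  case 0
  \<comment> \<open>For \<open>j = 0\<close> the formula involves the index -1; with
    \<open>s (- 1) = - s 1\<close> and \<open>s 0 = 0\<close> it collapses to
    \<open>x\<close>.\<close>
  have "0 < s 1" using s_pos[of 1] q_ge_5 by simp
  moreover have "s (- 1) = - s 1" by (simp add: s_def)
  ultimately show ?case by (simp add: s_def[of 0])
next
  case (Suc j)
  then have "lam + (G ^^ j) x =
      (s (real j + 1) * x + s (real j + 2)) / (s (real j) * x + s (real j + 1))"
    using G_denom[OF assms(1)] by simp
  moreover have "(G ^^ Suc j) x = - 1 / (lam + (G ^^ j) x)" by (simp add: mob_def)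
  moreover have "real (Suc j) = real j + 1" "real (Suc j) - 1 = real j"
    "real (Suc j) + 1 = real j + 2" by simp_all
  ultimately show ?case by (simp only: divide_divide_eq_right mult_minus1)
qed

lemma G_denom_pos:
  assumes "- 1 < x" "j \<le> h"
  shows "0 < lam + (G ^^ j) x"
proof -
  have "0 < s (real j) * x + s (real j + 1)" "0 < s (real j + 1) * x + s (real j + 2)"
    using s_denom_pos[OF assms(1), of j] s_denom_pos[OF assms(1), of "Suc j"] assms
    by (simp_all add: algebra_simps)
  then show ?thesis using G_denom[OF assms(1) _ G_iter[OF assms(1)], of j] assms(2) by simp
qed

lemma G_iter_mono:
  assumes "- 1 < x" "x \<le> y" "j \<le> h + 1"
  shows "(G ^^ j) x \<le> (G ^^ j) y"
  using assms(3)
proof (induction j)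
  case (Suc j)
  then show ?case using G_denom_pos[OF assms(1), of j] by (simp add: mob_mono)
qed (use assms in simp)

lemma G_iter_less:
  assumes "- 1 < x" "x < y" "j \<le> h + 1"
  shows "(G ^^ j) x < (G ^^ j) y"
  using assms(3)
proof (induction j)
  case (Suc j)
  then show ?case
    using G_denom_pos[of x j] G_denom_pos[of y j] assms by (simp add: mob_less_cancel)
qed (use assms in simp)

text \<open>An elliptic map has no real fixed point.\<close>

lemma G_less:
  assumes "0 < lam + x" shows "G x < x"
proof -
  have "lam * lam < 2 * 2" using lam_less_2 lam_gt_1 by (intro mult_strict_mono) auto
  moreover have "0 \<le> (x + lam / 2) * (x + lam / 2)" by simp
  ultimately have "0 < x * (lam + x) + 1" by (simp add: algebra_simps)
  then show ?thesis using assms by (simp add: mob_def divide_simps algebra_simps)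
qed

lemma G_iter_Suc_less: "- 1 < x \<Longrightarrow> j \<le> h \<Longrightarrow> (G ^^ Suc j) x < (G ^^ j) x"
  using G_less[OF G_denom_pos] by simp

lemma G_iter_antimono:
  assumes "- 1 < x" "i \<le> j" "j \<le> h + 1"
  shows "(G ^^ j) x \<le> (G ^^ i) x"
  using assms(2,3)
proof (induction j rule: dec_induct)
  case (step j)
  then show ?case using G_iter_Suc_less[OF assms(1), of j] by simp
qed simp

text \<open>As the two middle sines agree, the recursion run backwards expresses \<open>s h\<close>
  and \<open>s (h - 1)\<close> as multiples of \<open>c = s (h + 1)\<close>. The factor
  \<open>c\<close> cancels, and closed forms in \<open>lam\<close> alone remain.\<close>

lemma G_iter_h:
  assumes "- 1 < x" "0 < (lam - 1) * x + 1"
  shows "(G ^^ h) x = (x + 1) / ((lam - 1) * x + 1) - lam"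
    and "(G ^^ (h + 1)) x = - ((lam - 1) * x + 1) / (x + 1)"
proof -
  define c where "c = s (real h + 1)"
  have c: "0 < c" unfolding c_def using q_eq by (intro s_pos) auto
  have sh: "s (real h) = (lam - 1) * c"
    using s_rec[of "real h + 1"] s_mid by (simp add: c_def algebra_simps)
  have sh1: "s (real h - 1) = lam * ((lam - 1) * c) - c"
    using s_rec[of "real h"] sh by (simp add: c_def algebra_simps)
  have "(G ^^ h) x = - (s (real h - 1) * x + s (real h)) / (s (real h) * x + c)"
    using G_iter[OF assms(1), of h] by (simp add: c_def)
  also have "s (real h) * x + c = c * ((lam - 1) * x + 1)"
    unfolding sh by (simp add: algebra_simps)
  also have "- (s (real h - 1) * x + s (real h)) = c * ((x + 1) - lam * ((lam - 1) * x + 1))"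
    unfolding sh sh1 by (simp add: algebra_simps)
  finally show "(G ^^ h) x = (x + 1) / ((lam - 1) * x + 1) - lam"
    using c assms(2) by (simp add: diff_divide_distrib)
  have "(G ^^ (h + 1)) x = - (s (real h) * x + c) / (c * x + c)"
    using G_iter[OF assms(1), of "h + 1"] s_mid by (simp add: c_def add.commute add.assoc)
  also have "s (real h) * x + c = c * ((lam - 1) * x + 1)"
    unfolding sh by (simp add: algebra_simps)
  also have "c * x + c = c * (x + 1)" by (simp add: algebra_simps)
  finally show "(G ^^ (h + 1)) x = - ((lam - 1) * x + 1) / (x + 1)"
    using c by (metis mult_minus_right mult_divide_mult_cancel_left less_irrefl)
qed

section \<open>Iterates of \<open>G\<close> at \<open>R\<close>, \<open>mob 2 r\<close> and
  \<open>mob 2 p1\<close>\<close>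

definition p1 :: real where "p1 = 2 - lam + r"

lemma p1_bounds: "r < p1" "p1 < R" "- 1 < p1"
  using lam_less_2 lam_gt_1 r_bounds unfolding p1_def by linarith+

text \<open>The quadratic for \<open>R\<close> reads \<open>(lam - 1) * R + 1 = R * (R + 1)\<close>,
  so the factor \<open>R + 1\<close> cancels in the closed forms. The value \<open>p1\<close> will
  be the tail of \<open>r\<close> after its first digit 2.\<close>

lemma G_iter_R: "(G ^^ (h + 1)) R = - R" "(G ^^ h) R = p1"
proof -
  have pos: "0 < (lam - 1) * R + 1" using lam_gt_1 R_pos by (simp add: add_pos_pos)
  have e: "(lam - 1) * R + 1 = R * (R + 1)" using R_eq by (simp add: algebra_simps)
  have "- 1 < R" using R_pos by simp
  note G = G_iter_h[OF this pos]
  show "(G ^^ (h + 1)) R = - R" using G(2) R_pos by (simp add: e)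
  have "(R + 1) / (R * (R + 1)) = 1 / R" using R_pos by simp
  then show "(G ^^ h) R = p1" using G(1) inverse_R by (simp add: e p1_def)
qed

text \<open>Substituting \<open>mob 2 r = G R\<close> moves one application of \<open>G\<close> into
  the argument, so both values come from \<open>G_iter_R\<close>.\<close>

lemma G_iter_mob_2_r: "(G ^^ h) (mob 2 r) = - R" "(G ^^ (h - 1)) (mob 2 r) = p1"
proof -
  show "(G ^^ h) (mob 2 r) = - R"
    using G_iter_R(1) by (simp add: mob_2_r funpow_Suc_right del: funpow.simps)
  have "(G ^^ Suc (h - 1)) R = p1" using G_iter_R(2) h_pos by simp
  then show "(G ^^ (h - 1)) (mob 2 r) = p1"
    by (simp add: mob_2_r funpow_Suc_right del: funpow.simps)
qed

lemma mob_2_bounds: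
  assumes "r \<le> x" shows "- 1 < mob 2 x" "r < mob 2 x" "mob 2 x < 0"
proof -
  have p: "0 < 2 * lam + x" using assms lam_gt_1 r_bounds by linarith
  show "r < mob 2 x"
    using r_le_mob_2_r mob_mono[of 2 r x] assms lam_gt_1 r_bounds by force
  then show "- 1 < mob 2 x" using r_bounds by linarith
  show "mob 2 x < 0" using p by (simp add: mob_def)
qed

text \<open>Since \<open>2 * lam + p1 = lam + 1 / R\<close>, numerator and denominator of the closed
  form at \<open>mob 2 p1\<close> are \<open>R * (R + 1) / d\<close> and \<open>(R + 1) / d\<close>.
  Their quotient is \<open>R\<close>, which leaves \<open>R - lam = r\<close>.\<close>

lemma G_iter_mob_2_p1: "(G ^^ h) (mob 2 p1) = r"
proof -
  have p: "2 * lam + p1 = lam + 1 / R" by (simp add: p1_def inverse_R)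
  define d where "d = lam * R + 1"
  have d: "0 < d" using lam_gt_1 R_pos by (simp add: d_def add_pos_pos)
  have y: "mob 2 p1 = - R / d"
    using d R_pos unfolding mob_def of_int_numeral p by (simp add: d_def field_simps)
  have a: "mob 2 p1 + 1 = R * (R + 1) / d"
    unfolding y using d R_eq by (simp add: d_def field_simps)
  have b: "(lam - 1) * mob 2 p1 + 1 = (R + 1) / d"
    unfolding y using d by (simp add: d_def field_simps)
  have "0 < (lam - 1) * mob 2 p1 + 1" using b d R_pos by simp
  from G_iter_h(1)[OF mob_2_bounds(1) this] show ?thesis
    using p1_bounds d R_pos by (simp add: a b r_def)
qed

subsection \<open>Regular digit sequences\<close>

lemma map_upt_eq_replicate_iff:
  "map b [l..<l + n] = replicate n c \<longleftrightarrow> (\<forall>i<n. b (l + i) = c)"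
  by (auto simp: list_eq_iff_nth_eq)

lemma map_upt_eq_Cons_iff:
  "map b [l..<l + Suc n] = y # ys \<longleftrightarrow> b l = y \<and> map b [Suc l..<Suc l + n] = ys"
  by (simp add: upt_conv_Cons del: upt_Suc)

lemma map_upt_eq_append_iff:
  assumes "length xs = m"
  shows "map b [l..<l + (m + n)] = xs @ ys \<longleftrightarrow>
    map b [l..<l + m] = xs \<and> map b [l + m..<l + m + n] = ys"
proof -
  have "[l..<l + (m + n)] = [l..<l + m] @ [l + m..<l + m + n]"
    by (metis upt_add_eq_append le_add1 add.assoc)
  then show ?thesis using assms by (simp add: append_eq_append_conv)
qed

text \<open>The blocks are read backwards, so the last entry \<open>m * c\<close> of the long block
  comes first in \<open>b\<close>. As \<open>m \<ge> 1\<close> is arbitrary, that entry only demands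
  that \<open>b k\<close> has the sign of \<open>c\<close>.\<close>

lemma dual_regular_iff:
  "b \<in> dual_regular q \<longleftrightarrow>
    (\<forall>i. b i \<noteq> 0) \<and>
    (\<forall>c\<in>{1, - 1}. \<forall>k. \<exists>i\<le>h. b (k + i) \<noteq> c) \<and>
    (\<forall>c\<in>{1, - 1}. \<forall>k. 0 < b k * c \<longrightarrow> (\<forall>i<h. b (Suc k + i) = c) \<longrightarrow> b (Suc k + h) = 2 * c \<longrightarrow>
       (\<exists>i<h. b (Suc k + h + 1 + i) \<noteq> c))" (is "_ \<longleftrightarrow> ?N \<and> ?A \<and> ?B")
proof -
  have block1: "rev (map b [l..<Suc L]) = replicate (h + 1) c \<longleftrightarrow>
      L = l + h \<and> (\<forall>i\<le>h. b (l + i) = c)" if "l < L" for l L c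
  proof -
    have "rev (map b [l..<Suc L]) = replicate (h + 1) c \<longleftrightarrow>
        map b [l..<Suc L] = replicate (h + 1) c"
      by (metis rev_rev_ident rev_replicate)
    also have "\<dots> \<longleftrightarrow> L = l + h \<and> map b [l..<l + (h + 1)] = replicate (h + 1) c"
    proof -
      have "L = l + h" if "map b [l..<Suc L] = replicate (h + 1) c"
        using arg_cong[OF that, of length] \<open>l < L\<close> by simp
      then show ?thesis by fastforce
    qed
    also have "\<dots> \<longleftrightarrow> L = l + h \<and> (\<forall>i\<le>h. b (l + i) = c)"
      unfolding map_upt_eq_replicate_iff by (simp add: less_Suc_eq_le)
    finally show ?thesis .
  qed
  have block2: "rev (map b [l..<Suc L]) = replicate h c @ [2 * c] @ replicate h c @ [m * c] \<longleftrightarrow>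
      L = l + (2 * h + 1) \<and> b l = m * c \<and> (\<forall>i<h. b (Suc l + i) = c) \<and> b (Suc l + h) = 2 * c \<and>
      (\<forall>i<h. b (Suc l + h + 1 + i) = c)" if "l < L" for l L c m
  proof -
    \<comment> \<open>The long block reversed, in the order in which its entries occur in
      \<open>b\<close>.\<close>
    let ?w = "m * c # replicate h c @ 2 * c # replicate h c"
    have "rev (map b [l..<Suc L]) = replicate h c @ [2 * c] @ replicate h c @ [m * c] \<longleftrightarrow>
        map b [l..<Suc L] = ?w"
      by (subst rev_swap) simp
    also have "\<dots> \<longleftrightarrow> L = l + (2 * h + 1) \<and> map b [l..<l + Suc (h + Suc h)] = ?w"
    proof -
      have "L = l + (2 * h + 1)" if "map b [l..<Suc L] = ?w"
        using arg_cong[OF that, of length] \<open>l < L\<close> by simp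
      moreover have "Suc (l + (2 * h + 1)) = l + Suc (h + Suc h)" by simp
      ultimately show ?thesis by metis
    qed
    also have "map b [l..<l + Suc (h + Suc h)] = ?w \<longleftrightarrow> b l = m * c \<and>
        (\<forall>i<h. b (Suc l + i) = c) \<and> b (Suc l + h) = 2 * c \<and> (\<forall>i<h. b (Suc l + h + 1 + i) = c)"
      unfolding map_upt_eq_Cons_iff map_upt_eq_append_iff[OF length_replicate]
        map_upt_eq_replicate_iff by simp
    finally show ?thesis .
  qed
  have mem: "w \<in> forbidden_blocks q \<longleftrightarrow> (\<exists>c\<in>{1, - 1}. w = replicate (h + 1) c) \<or>
      (\<exists>c\<in>{1, - 1}. \<exists>m\<ge>1. w = replicate h c @ [2 * c] @ replicate h c @ [m * c])" for w
    unfolding forbidden_blocks_def by blast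
  have "(\<forall>l L. l < L \<longrightarrow> rev (map b [l..<Suc L]) \<notin> forbidden_blocks q) \<longleftrightarrow> ?A \<and> ?B"
  proof
    assume reg: "\<forall>l L. l < L \<longrightarrow> rev (map b [l..<Suc L]) \<notin> forbidden_blocks q"
    have "\<exists>i\<le>h. b (k + i) \<noteq> c" if c: "c \<in> {1, - 1}" for c k
    proof (rule ccontr)
      have "k < k + h" using h_pos by simp
      note B = block1[OF this, of c]
      assume "\<not> ?thesis"
      then have "rev (map b [k..<Suc (k + h)]) = replicate (h + 1) c" unfolding B by blast
      then have "rev (map b [k..<Suc (k + h)]) \<in> forbidden_blocks q" unfolding mem using c by blast
      then show False using reg \<open>k < k + h\<close> by blast
    qed
    moreover have "\<exists>i<h. b (Suc k + h + 1 + i) \<noteq> c" if c: "c \<in> {1, - 1}" and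
      k: "0 < b k * c" "\<forall>i<h. b (Suc k + i) = c" "b (Suc k + h) = 2 * c" for c k
    proof (rule ccontr)
      have less: "k < k + (2 * h + 1)" by simp
      note B = block2[OF less, of c "b k * c"]
      \<comment> \<open>Since \<open>c * c = 1\<close>, the number \<open>b k * c\<close> is the
        \<open>m\<close> of the block.\<close>
      have "b k = b k * c * c" using c by (elim insertE emptyE) simp_all
      moreover assume "\<not> ?thesis"
      ultimately have "rev (map b [k..<Suc (k + (2 * h + 1))]) =
          replicate h c @ [2 * c] @ replicate h c @ [b k * c * c]"
        unfolding B using k by blast
      moreover have "1 \<le> b k * c" using k by linarith
      ultimately have "rev (map b [k..<Suc (k + (2 * h + 1))]) \<in> forbidden_blocks q"
        unfolding mem using c by blast
      then show False using reg less by blast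
    qed
    ultimately show "?A \<and> ?B" by blast
  next
    assume AB: "?A \<and> ?B"
    show "\<forall>l L. l < L \<longrightarrow> rev (map b [l..<Suc L]) \<notin> forbidden_blocks q"
    proof (intro allI impI notI)
      fix l L :: nat assume less: "l < L" and "rev (map b [l..<Suc L]) \<in> forbidden_blocks q"
      then consider c where "c \<in> {1, - 1}" "rev (map b [l..<Suc L]) = replicate (h + 1) c"
        | c m where "c \<in> {1, - 1}" "1 \<le> m"
          "rev (map b [l..<Suc L]) = replicate h c @ [2 * c] @ replicate h c @ [m * c]"
        unfolding mem by blast
      then show False
      proof cases
        case 1
        then have "\<forall>i\<le>h. b (l + i) = c" using block1[OF less] by blast
        then show False using AB 1(1) by blast
      next
        case 2
        then have B: "b l = m * c" "\<forall>i<h. b (Suc l + i) = c" "b (Suc l + h) = 2 * c"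
          "\<forall>i<h. b (Suc l + h + 1 + i) = c"
          using block2[OF less] by blast+
        have "b l * c = m" using 2(1) B(1) by (elim insertE emptyE) simp_all
        then have "0 < b l * c" using 2(2) by linarith
        then show False using AB 2(1) B(2-4) by blast
      qed
    qed
  qed
  then show ?thesis unfolding dual_regular_def by blast
qed

lemma dual_regular_nonzero: "b \<in> dual_regular q \<Longrightarrow> b i \<noteq> 0"
  by (simp add: dual_regular_def)

lemma dual_regular_ones: "b \<in> dual_regular q \<Longrightarrow> \<exists>i\<le>h. b (k + i) \<noteq> 1"
  by (simp add: dual_regular_iff)

lemma dual_regular_two:
  assumes "b \<in> dual_regular q" "0 < b k" "\<And>i. i < h \<Longrightarrow> b (Suc k + i) = 1" "b (Suc k + h) = 2"
  shows "\<exists>i<h. b (Suc k + h + 1 + i) \<noteq> 1"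
  using assms unfolding dual_regular_iff by simp

lemma dual_regular_uminus:
  assumes "b \<in> dual_regular q"
  shows "- b \<in> dual_regular q"
proof -
  have "- b i = 1 \<longleftrightarrow> b i = - 1" "- b i = 2 \<longleftrightarrow> b i = - 2" for i by linarith+
  then show ?thesis using assms unfolding dual_regular_iff by simp
qed

lemma dual_regular_drop:
  assumes "b \<in> dual_regular q"
  shows "(\<lambda>i. b (n + i)) \<in> dual_regular q"
proof -
  have "rev (map (\<lambda>i. b (n + i)) [l..<Suc L]) = rev (map b [n + l..<Suc (n + L)])" for l L
    by (intro arg_cong[where f = rev] nth_equalityI) (simp_all add: add.assoc del: upt_Suc)
  then show ?thesis using assms by (simp add: dual_regular_def del: upt_Suc)
qed

subsection \<open>Tails of finite regular expansions\<close>

lemma G_iter_tail: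
  assumes "\<And>i. i < j \<Longrightarrow> x (k + i) = mob (b (k + i)) (x (Suc (k + i)))"
    and "\<And>i. i < j \<Longrightarrow> b (k + i) = 1"
  shows "x k = (G ^^ j) (x (k + j))"
  using assms
proof (induction j arbitrary: k)
  case (Suc j)
  have "x (Suc k) = (G ^^ j) (x (Suc k + j))"
    using Suc.prems[of "Suc _"] by (intro Suc.IH) auto
  then show ?case using Suc.prems[of 0] by simp
qed simp

text \<open>Here \<open>x k\<close> is the value of the tail \<open>b\<^sub>k, \<dots>, b\<^bsub>n-1\<^esub>\<close>.\<close>

definition fin_expansion :: "(nat \<Rightarrow> int) \<Rightarrow> (nat \<Rightarrow> real) \<Rightarrow> nat \<Rightarrow> bool" where
  "fin_expansion b x n \<longleftrightarrow> x n = 0 \<and> (\<forall>k<n. x k = mob (b k) (x (Suc k)))"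

text \<open>Only lower bounds are recorded; the upper ones are the same predicate for
  \<open>- b\<close> and \<open>- x\<close>. No digit precedes the place 0, so only
  \<open>- R\<close> is claimed there.\<close>

definition lower_ok :: "(nat \<Rightarrow> int) \<Rightarrow> (nat \<Rightarrow> real) \<Rightarrow> nat \<Rightarrow> bool" where
  "lower_ok b x k \<longleftrightarrow> - R \<le> x k \<and> (\<forall>j. k = Suc j \<longrightarrow> 0 < b j \<longrightarrow> r \<le> x k)"

text \<open>The proof looks at the run of digits 1 starting at \<open>k\<close>, of length
  \<open>j \<le> h\<close> by regularity. If \<open>j < h\<close>, the value is at least
  \<open>p1\<close>. If \<open>j = h\<close> and no 2 follows, it is at least
  \<open>(G ^^ h) (mob 2 p1) = r\<close>. If a 2 follows, the bound is
  \<open>(G ^^ h) (mob 2 r) = - R\<close>, and it improves to \<open>r\<close> after a positive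
  digit.\<close>

lemma lower_ok_step:
  assumes reg: "b \<in> dual_regular q" and x: "fin_expansion b x n" and "k \<le> n"
    and IH: "\<And>m. k < m \<Longrightarrow> m \<le> n \<Longrightarrow> lower_ok b x m \<and> lower_ok (- b) (- x) m"
  shows "lower_ok b x k"
proof -
  have x_rec: "x m = mob (b m) (x (Suc m))" if "m < n" for m
    using x that by (auto simp: fin_expansion_def)
  have xn: "x n = 0" using x by (simp add: fin_expansion_def)
  have tail_r: "r \<le> x (Suc m)" if "k \<le> m" "m < n" "0 < b m" for m
    using IH[of "Suc m"] that by (auto simp: lower_ok_def)
  have neg: "0 \<le> x m" if "k \<le> m" "m < n" "b m < 0" for m
  proof -
    have "x (Suc m) \<le> - r" using IH[of "Suc m"] that by (auto simp: lower_ok_def)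
    moreover have "of_int (b m) * lam \<le> (- 1) * lam"
      using that lam_gt_1 by (intro mult_right_mono) auto
    ultimately have "of_int (b m) * lam + x (Suc m) < 0" using r_bounds R_pos by linarith
    then show ?thesis using x_rec[OF that(2)] by (simp add: mob_def)
  qed
  have mob_ge: "mob 2 t \<le> mob c y"
    if "0 < 2 * lam + t" "of_int 2 * lam + t \<le> of_int c * lam + y" for c t y
    using that unfolding mob_def by (simp add: frac_le)
  \<comment> \<open>When a run of ones has ended, the smallest possible value is digit 2 followed by
    \<open>r\<close>; a negative digit or the end of the list gives a nonnegative value.\<close>
  have ge2: "mob 2 r \<le> x m" if m: "k \<le> m" "m \<le> n" "m = n \<or> b m \<noteq> 1" for m
  proof (cases "m = n \<or> b m < 0")
    case True
    then have "0 \<le> x m" using neg[of m] m xn by (cases "m = n") auto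
    then show ?thesis using mob_2_bounds(3)[of r] by simp
  next
    case False
    then have bm: "2 \<le> b m" using m dual_regular_nonzero[OF reg, of m] by linarith
    then have "of_int 2 * lam \<le> of_int (b m) * lam"
      using lam_gt_1 by (intro mult_right_mono) auto
    moreover have "r \<le> x (Suc m)" using tail_r False bm m by auto
    ultimately have "of_int 2 * lam + r \<le> of_int (b m) * lam + x (Suc m)" by linarith
    then show ?thesis
      using x_rec[of m] mob_ge[of r "b m" "x (Suc m)"] False m lam_gt_1 r_bounds by auto
  qed
  have ge3: "mob 2 R \<le> x m" if m: "k \<le> m" "m \<le> n" "m = n \<or> b m \<noteq> 1 \<and> b m \<noteq> 2" for m
  proof (cases "m = n \<or> b m < 0")
    \<comment> \<open>With a negative digit or at the end the value is nonnegative. Otherwise the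
      smallest case is digit 3 followed by \<open>r\<close>, and
      \<open>3 * lam + r = 2 * lam + R\<close>.\<close>
    case True
    then have "0 \<le> x m" using neg[of m] m xn by (cases "m = n") auto
    then show ?thesis using mob_2_bounds(3)[of R] r_bounds by simp
  next
    case False
    then have bm: "3 \<le> b m" using m dual_regular_nonzero[OF reg, of m] by linarith
    then have "of_int 3 * lam \<le> of_int (b m) * lam"
      using lam_gt_1 by (intro mult_right_mono) auto
    moreover have "r \<le> x (Suc m)" using tail_r False bm m by auto
    ultimately have "of_int 2 * lam + R \<le> of_int (b m) * lam + x (Suc m)"
      using r_bounds(5) by simp
    then show ?thesis
      using x_rec[of m] mob_ge[of R "b m" "x (Suc m)"] False m lam_gt_1 R_pos by auto
  qed
  have run: "\<exists>j\<le>h. m + j \<le> n \<and> (m + j = n \<or> b (m + j) \<noteq> 1) \<and> (\<forall>i<j. b (m + i) = 1) \<and>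
      x m = (G ^^ j) (x (m + j))" if "k \<le> m" "m \<le> n" for m
  proof -
    \<comment> \<open>The end of the list counts as a break of the run, since there the value is
      0.\<close>
    define j where "j = (LEAST j. m + j = n \<or> b (m + j) \<noteq> 1)"
    have j: "m + j = n \<or> b (m + j) \<noteq> 1" unfolding j_def
      by (rule LeastI[of _ "n - m"]) (use that in simp)
    have less: "m + i \<noteq> n \<and> b (m + i) = 1" if "i < j" for i
      using not_less_Least[of i, folded j_def] that unfolding j_def by blast
    have "m + j \<le> n" using less[of "n - m"] that by force
    moreover obtain i where "i \<le> h" "b (m + i) \<noteq> 1" using dual_regular_ones[OF reg] by blast
    then have "j \<le> h" using less[of i] by force
    moreover have "x m = (G ^^ j) (x (m + j))"
    proof (rule G_iter_tail[where b = b])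
      show "x (m + i) = mob (b (m + i)) (x (Suc (m + i)))" if "i < j" for i
        by (rule x_rec) (use that \<open>m + j \<le> n\<close> in linarith)
    qed (use less in blast)
    ultimately show ?thesis using j less by blast
  qed
  obtain j where j: "j \<le> h" "k + j \<le> n" "k + j = n \<or> b (k + j) \<noteq> 1" "\<And>i. i < j \<Longrightarrow> b (k + i) = 1"
    "x k = (G ^^ j) (x (k + j))"
    using run[of k] \<open>k \<le> n\<close> by blast
  show ?thesis
  proof (cases "j = h \<and> k + h \<noteq> n \<and> b (k + h) = 2")
    case False
    have "r \<le> x k"
    proof (cases "j = h")
      case True
      then have "mob 2 R \<le> x (k + h)" using ge3[of "k + h"] j False by auto
      moreover have "mob 2 p1 \<le> mob 2 R"
        using p1_bounds lam_gt_1 by (intro mob_mono) auto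
      ultimately have "(G ^^ h) (mob 2 p1) \<le> (G ^^ h) (x (k + h))"
        using mob_2_bounds(1)[of p1] p1_bounds by (intro G_iter_mono) auto
      then show ?thesis using j True G_iter_mob_2_p1 by simp
    next
      case False
      \<comment> \<open>The iterates decrease with \<open>j\<close>, and
        \<open>(G ^^ (h - 1)) (mob 2 r)\<close> is exactly \<open>p1\<close>.\<close>
      have "p1 \<le> (G ^^ j) (mob 2 r)"
        using G_iter_antimono[of "mob 2 r" j "h - 1"] G_iter_mob_2_r mob_2_bounds(1)[of r] False j
        by simp
      also have "\<dots> \<le> x k"
        using j ge2[of "k + j"] mob_2_bounds(1)[of r] by (auto intro!: G_iter_mono)
      finally show ?thesis using p1_bounds by simp
    qed
    moreover have "- R \<le> x k" using \<open>r \<le> x k\<close> r_bounds by linarith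
    ultimately show ?thesis by (auto simp: lower_ok_def)
  next
    case True
    define m where "m = Suc (k + h)"
    have m: "m \<le> n" "k \<le> m" "x (k + h) = mob 2 (x m)"
      using True j x_rec[of "k + h"] by (auto simp: m_def)
    have bound: "(G ^^ h) (mob 2 t) \<le> x k" if "r \<le> t" "t \<le> x m" for t
    proof -
      have "mob 2 t \<le> mob 2 (x m)" using that lam_gt_1 r_bounds by (intro mob_mono) auto
      then show ?thesis
        using j True m mob_2_bounds(1)[OF that(1)] by (auto intro!: G_iter_mono)
    qed
    have "r \<le> x m" using tail_r[of "k + h"] True j by (auto simp: m_def)
    then have "- R \<le> x k" using bound[of r] G_iter_mob_2_r by simp
    moreover have "r \<le> x k" if k: "k = Suc i" "0 < b i" for i
    proof -
      \<comment> \<open>A positive digit before \<open>k\<close> makes the long forbidden block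
        relevant: the run after the digit 2 has fewer than \<open>h\<close> ones, so
        \<open>x m \<ge> p1\<close> instead of merely \<open>r\<close>.\<close>
      obtain l where l: "l < h" "b (m + l) \<noteq> 1"
        using dual_regular_two[OF reg k(2)] j True k by (auto simp: m_def)
      obtain l' where l': "m + l' \<le> n" "m + l' = n \<or> b (m + l') \<noteq> 1"
        "\<And>i. i < l' \<Longrightarrow> b (m + i) = 1" "x m = (G ^^ l') (x (m + l'))"
        using run[of m] m by blast
      have "l' \<le> l" using l l' not_le_imp_less by blast
      then have "p1 \<le> (G ^^ l') (mob 2 r)"
        using G_iter_antimono[of "mob 2 r" l' "h - 1"] G_iter_mob_2_r mob_2_bounds(1)[of r] l
        by simp
      also have "\<dots> \<le> x m"
        using l l' \<open>l' \<le> l\<close> m ge2[of "m + l'"] mob_2_bounds(1)[of r] by (auto intro!: G_iter_mono)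
      finally show ?thesis using bound[of p1] p1_bounds G_iter_mob_2_p1 by simp
    qed
    ultimately show ?thesis by (auto simp: lower_ok_def)
  qed
qed

lemma fin_expansion_uminus: "fin_expansion b x n \<Longrightarrow> fin_expansion (- b) (- x) n"
  by (simp add: fin_expansion_def mob_minus)

text \<open>Downward induction on \<open>k\<close> for both signs at once, because the step for
  \<open>b\<close> uses the upper bounds on later tails after negative digits.\<close>

lemma fin_expansion_lower_ok:
  assumes "b \<in> dual_regular q" "fin_expansion b x n" "k \<le> n"
  shows "lower_ok b x k \<and> lower_ok (- b) (- x) k"
  using assms(3)
proof (induction "n - k" arbitrary: k rule: less_induct)
  case less
  then have IH: "lower_ok b x m \<and> lower_ok (- b) (- x) m" if "k < m" "m \<le> n" for m
    using that by simp
  then have "lower_ok (- b) (- x) m \<and> lower_ok (- (- b)) (- (- x)) m" if "k < m" "m \<le> n" for m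
    using that by (simp add: fun_Compl_def)
  then show ?case
    using lower_ok_step[OF assms(1,2) less.prems IH]
      lower_ok_step[OF dual_regular_uminus fin_expansion_uminus, OF assms(1,2) less.prems] by blast
qed

subsection \<open>Convergence\<close>

lemma denom_pos:
  assumes "0 < c" "\<bar>x\<bar> \<le> R"
  shows "0 < of_int c * lam + x"
proof -
  have "1 * lam \<le> of_int c * lam" using assms lam_gt_1 by (intro mult_right_mono) auto
  then show ?thesis using assms r_bounds by linarith
qed

lemma denom_nonzero:
  assumes "c \<noteq> 0" "\<bar>x\<bar> \<le> R"
  shows "of_int c * lam + x \<noteq> 0"
  using denom_pos[of c x] denom_pos[of "- c" "- x"] assms by (cases "0 < c") auto

lemma mob_diff:
  assumes "c \<noteq> 0" "\<bar>x\<bar> \<le> R" "\<bar>y\<bar> \<le> R"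
  shows "mob c x - mob c y = mob c x * mob c y * (x - y)"
  using denom_nonzero[OF assms(1,2)] denom_nonzero[OF assms(1,3)]
  unfolding mob_def by (simp add: divide_simps)

text \<open>By \<open>mob_diff\<close> each digit multiplies the difference by the product of the
  two values at that place, which is at most \<open>R * R\<close> in absolute value.\<close>

lemma contraction:
  assumes "\<And>i. b i \<noteq> 0"
    and "\<And>i. i < d \<Longrightarrow> x (k + i) = mob (b (k + i)) (x (Suc (k + i)))"
    and "\<And>i. i < d \<Longrightarrow> y (k + i) = mob (b (k + i)) (y (Suc (k + i)))"
    and "\<And>i. i \<le> d \<Longrightarrow> \<bar>x (k + i)\<bar> \<le> R \<and> \<bar>y (k + i)\<bar> \<le> R"
  shows "\<bar>x k - y k\<bar> \<le> (R * R) ^ d * \<bar>x (k + d) - y (k + d)\<bar>"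
  using assms(2-4)
proof (induction d arbitrary: k)
  case (Suc d)
  have IH: "\<bar>x (Suc k) - y (Suc k)\<bar> \<le> (R * R) ^ d * \<bar>x (Suc k + d) - y (Suc k + d)\<bar>"
    using Suc.prems[of "Suc _"] by (intro Suc.IH) auto
  have b: "\<bar>x k\<bar> \<le> R" "\<bar>y k\<bar> \<le> R" "\<bar>x (Suc k)\<bar> \<le> R" "\<bar>y (Suc k)\<bar> \<le> R"
    using Suc.prems(3)[of 0] Suc.prems(3)[of 1] by auto
  have "x k - y k = x k * y k * (x (Suc k) - y (Suc k))"
    using Suc.prems(1,2)[of 0] mob_diff[OF assms(1) b(3,4)] by simp
  then have "\<bar>x k - y k\<bar> = (\<bar>x k\<bar> * \<bar>y k\<bar>) * \<bar>x (Suc k) - y (Suc k)\<bar>" by (simp add: abs_mult)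
  also have "\<dots> \<le> (R * R) * \<bar>x (Suc k) - y (Suc k)\<bar>"
    using b R_pos by (intro mult_right_mono mult_mono) auto
  also have "\<dots> \<le> (R * R) * ((R * R) ^ d * \<bar>x (Suc k + d) - y (Suc k + d)\<bar>)"
    using IH R_pos by (intro mult_left_mono) auto
  finally show ?case by simp
qed simp

lemma contraction_null: "(\<lambda>n. (R * R) ^ n * (2 * R)) \<longlonglongrightarrow> 0"
proof -
  have "R * R < 1 * 1" using R_pos R_less_1 by (intro mult_strict_mono) auto
  then show ?thesis using R_pos by (auto intro!: tendsto_mult_left_zero LIMSEQ_realpow_zero)
qed

text \<open>The truncation point comes before the starting place, so that \<open>cf_tail b n\<close>
  is a sequence of tails as in \<open>fin_expansion\<close>.\<close>

definition cf_tail :: "(nat \<Rightarrow> int) \<Rightarrow> nat \<Rightarrow> nat \<Rightarrow> real" where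
  "cf_tail b n k = rosen_cf_fin q (map b [k..<n])"

lemma cf_tail_rec: "k < n \<Longrightarrow> cf_tail b n k = mob (b k) (cf_tail b n (Suc k))"
  by (simp add: cf_tail_def mob_def upt_conv_Cons)

lemma cf_tail_bounds:
  assumes "b \<in> dual_regular q" "k \<le> n"
  shows "\<bar>cf_tail b n k\<bar> \<le> R"
    and "k = Suc j \<Longrightarrow> 0 < b j \<Longrightarrow> r \<le> cf_tail b n k"
    and "k = Suc j \<Longrightarrow> b j < 0 \<Longrightarrow> cf_tail b n k \<le> - r"
proof -
  have "fin_expansion b (cf_tail b n) n"
    using cf_tail_rec by (simp add: fin_expansion_def) (simp add: cf_tail_def)
  from fin_expansion_lower_ok[OF assms(1) this assms(2)]
  show "\<bar>cf_tail b n k\<bar> \<le> R"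
    and "k = Suc j \<Longrightarrow> 0 < b j \<Longrightarrow> r \<le> cf_tail b n k"
    and "k = Suc j \<Longrightarrow> b j < 0 \<Longrightarrow> cf_tail b n k \<le> - r"
    by (auto simp: lower_ok_def)
qed

lemma cf_defined:
  assumes "b \<in> dual_regular q"
  shows "rosen_cf_defined q (map b [k..<n])"
proof (induction "n - k" arbitrary: k)
  case (Suc d)
  then have "k < n" "d = n - Suc k" by auto
  with Suc.hyps(1)[of "Suc k"] show ?case
    using denom_nonzero[OF dual_regular_nonzero cf_tail_bounds(1), OF assms assms, of "Suc k" n k]
    by (simp add: upt_conv_Cons cf_tail_def)
qed simp

text \<open>The common form of limits of truncated tails and of orbits of the dual map with their
  digits.\<close>

definition expansion :: "(nat \<Rightarrow> int) \<Rightarrow> (nat \<Rightarrow> real) \<Rightarrow> bool" where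
  "expansion b x \<longleftrightarrow> (\<forall>k. b k \<noteq> 0 \<and> \<bar>x k\<bar> \<le> R \<and> x k = mob (b k) (x (Suc k)) \<and>
     (0 < b k \<longrightarrow> r \<le> x (Suc k)) \<and> (b k < 0 \<longrightarrow> x (Suc k) \<le> - r))"

lemma expansionI:
  assumes "\<And>k. b k \<noteq> 0" "\<And>k. \<bar>x k\<bar> \<le> R" "\<And>k. x k = mob (b k) (x (Suc k))"
    "\<And>k. 0 < b k \<Longrightarrow> r \<le> x (Suc k)" "\<And>k. b k < 0 \<Longrightarrow> x (Suc k) \<le> - r"
  shows "expansion b x"
  unfolding expansion_def using assms by blast

lemma expansionD:
  assumes "expansion b x"
  shows "b k \<noteq> 0" "\<bar>x k\<bar> \<le> R" "x k = mob (b k) (x (Suc k))"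
    "0 < b k \<Longrightarrow> r \<le> x (Suc k)" "b k < 0 \<Longrightarrow> x (Suc k) \<le> - r"
  using assms unfolding expansion_def by blast+

lemma expansion_uminus:
  assumes "expansion b x"
  shows "expansion (- b) (- x)"
proof (rule expansionI)
  fix k
  show "(- x) k = mob ((- b) k) ((- x) (Suc k))"
    using expansionD(3)[OF assms, of k] by (simp add: mob_minus)
  show "(- x) (Suc k) \<le> - r" if "(- b) k < 0" using expansionD(4)[OF assms, of k] that by simp
  show "r \<le> (- x) (Suc k)" if "0 < (- b) k" using expansionD(5)[OF assms, of k] that by simp
qed (use expansionD(1,2)[OF assms] in simp_all)

lemma expansion_drop: "expansion b x \<Longrightarrow> expansion (\<lambda>i. b (n + i)) (\<lambda>i. x (n + i))"
  unfolding expansion_def add_Suc_right by blast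

text \<open>Truncating \<open>d\<close> places after \<open>k\<close> leaves \<open>d\<close>
  contraction steps and an initial error of at most \<open>2 * R\<close>. Hence the values of an
  expansion are determined by its digits.\<close>

lemma cf_tail_tendsto:
  assumes reg: "b \<in> dual_regular q" and x: "expansion b x"
  shows "(\<lambda>n. cf_tail b n k) \<longlonglongrightarrow> x k"
proof -
  have "\<bar>cf_tail b (d + k) k - x k\<bar> \<le> (R * R) ^ d * (2 * R)" for d
  proof -
    have "\<bar>cf_tail b (d + k) k - x k\<bar>
        \<le> (R * R) ^ d * \<bar>cf_tail b (d + k) (k + d) - x (k + d)\<bar>"
    proof (rule contraction[where b = b])
      show "x (k + i) = mob (b (k + i)) (x (Suc (k + i)))" for i by (rule expansionD(3)[OF x])
    qed (use dual_regular_nonzero[OF reg] cf_tail_rec cf_tail_bounds(1)[OF reg]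
        expansionD(2)[OF x] in auto)
    also have "\<dots> \<le> (R * R) ^ d * (2 * R)"
      using expansionD(2)[OF x, of "k + d"] R_pos cf_tail_bounds(1)[OF reg, of "k + d" "d + k"]
      by (intro mult_left_mono) auto
    finally show ?thesis .
  qed
  then have "(\<lambda>d. cf_tail b (d + k) k - x k) \<longlonglongrightarrow> 0"
    using R_pos by (intro tendsto_0_le[OF contraction_null, of _ 1]) (simp add: abs_mult)
  then have "(\<lambda>d. cf_tail b (d + k) k) \<longlonglongrightarrow> x k" by (simp add: LIM_zero_iff)
  then show ?thesis by (rule LIMSEQ_offset)
qed

text \<open>Two truncations share the digits up to the shorter one, so the contraction gives the
  Cauchy property.\<close>

lemma cf_tail_convergent:
  assumes reg: "b \<in> dual_regular q"
  shows "convergent (\<lambda>n. cf_tail b n k)"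
proof -
  have le: "\<bar>cf_tail b (m + k) k - cf_tail b (n + k) k\<bar> \<le> (R * R) ^ m * (2 * R)" if "m \<le> n" for m n
  proof -
    have "\<bar>cf_tail b (m + k) k - cf_tail b (n + k) k\<bar>
        \<le> (R * R) ^ m * \<bar>cf_tail b (m + k) (k + m) - cf_tail b (n + k) (k + m)\<bar>"
      using dual_regular_nonzero[OF reg] cf_tail_rec cf_tail_bounds(1)[OF reg] that
      by (intro contraction[where b = b]) auto
    also have "\<dots> \<le> (R * R) ^ m * (2 * R)"
      using cf_tail_bounds(1)[OF reg, of "k + m" "m + k"] R_pos
        cf_tail_bounds(1)[OF reg, of "k + m" "n + k"] that
      by (intro mult_left_mono) auto
    finally show ?thesis .
  qed
  have "Cauchy (\<lambda>n. cf_tail b (n + k) k)"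
  proof (rule CauchyI')
    fix e :: real assume "0 < e"
    then obtain M where M: "\<bar>(R * R) ^ m * (2 * R)\<bar> < e" if "m \<ge> M" for m
      using LIMSEQ_D[OF contraction_null] by auto
    have "dist (cf_tail b (m + k) k) (cf_tail b (n + k) k) < e" if "m \<ge> M" "n > m" for m n
      using le[of m n] M[of m] that unfolding dist_real_def by linarith
    then show "\<exists>M. \<forall>m\<ge>M. \<forall>n>m. dist (cf_tail b (m + k) k) (cf_tail b (n + k) k) < e"
      by blast
  qed
  then show ?thesis
    using convergent_ignore_initial_segment[of "\<lambda>n. cf_tail b n k" k]
    by (simp add: Cauchy_convergent_iff)
qed

text \<open>The bounds on the truncated tails are closed conditions and \<open>mob (b k)\<close> is
  continuous on \<open>[- R, R]\<close>, so bounds and recursion pass to the limit.\<close>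

lemma cf_tail_lim_expansion:
  assumes reg: "b \<in> dual_regular q"
  shows "expansion b (\<lambda>k. lim (\<lambda>n. cf_tail b n k))"
proof -
  define x where "x = (\<lambda>k. lim (\<lambda>n. cf_tail b n k))"
  have lim: "(\<lambda>n. cf_tail b n k) \<longlonglongrightarrow> x k" for k
    using cf_tail_convergent[OF reg] by (simp add: x_def convergent_LIMSEQ_iff)
  have bd: "\<bar>x k\<bar> \<le> R" for k
    by (rule LIMSEQ_le_const2[OF tendsto_rabs[OF lim]]) (use cf_tail_bounds(1)[OF reg] in blast)
  have "expansion b x"
  proof (rule expansionI)
    fix k
    have nz: "b k \<noteq> 0" using dual_regular_nonzero[OF reg] .
    then show "b k \<noteq> 0" .
    have "(\<lambda>n. mob (b k) (cf_tail b n (Suc k))) \<longlonglongrightarrow> mob (b k) (x (Suc k))"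
      unfolding mob_def by (intro tendsto_intros lim denom_nonzero[OF nz bd])
    moreover have "\<forall>\<^sub>F n in sequentially. mob (b k) (cf_tail b n (Suc k)) = cf_tail b n k"
      unfolding eventually_sequentially by (intro exI[of _ "Suc k"]) (simp add: cf_tail_rec)
    ultimately have "(\<lambda>n. cf_tail b n k) \<longlonglongrightarrow> mob (b k) (x (Suc k))" by (rule Lim_transform_eventually)
    then show "x k = mob (b k) (x (Suc k))" using lim LIMSEQ_unique by blast
    show "r \<le> x (Suc k)" if "0 < b k"
      by (rule LIMSEQ_le_const[OF lim]) (use cf_tail_bounds(2)[OF reg _ refl that] in blast)
    show "x (Suc k) \<le> - r" if "b k < 0"
      by (rule LIMSEQ_le_const2[OF lim]) (use cf_tail_bounds(3)[OF reg _ refl that] in blast)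
  qed (rule bd)
  then show ?thesis by (simp add: x_def)
qed

lemma rosen_cf_eq:
  assumes "b \<in> dual_regular q" "expansion b x"
  shows "rosen_cf q b = x 0"
  using limI[OF cf_tail_tendsto[OF assms, of 0]]
  by (simp add: rosen_cf_def seq_prefix_def cf_tail_def)

lemma rosen_cf_converges:
  assumes "b \<in> dual_regular q"
  shows "rosen_cf_converges q b"
  using cf_tail_convergent[OF assms, of 0] cf_defined[OF assms]
  by (simp add: rosen_cf_converges_def seq_prefix_def cf_tail_def)

section \<open>Regularity of the digits of an expansion\<close>

lemma expansion_imp_dual_regular:
  assumes x: "expansion b x" and strict: "\<And>k. b k \<noteq> 0 \<Longrightarrow> \<bar>x (Suc k)\<bar> < R"
  shows "b \<in> dual_regular q"
proof -
  have ones: "\<exists>i\<le>h. b (k + i) \<noteq> 1"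
    if x: "expansion b x" and strict: "\<And>k. \<bar>x (Suc k)\<bar> < R" for b x k
  proof (rule ccontr)
    assume "\<not> ?thesis"
    then have "x k = (G ^^ (h + 1)) (x (k + (h + 1)))"
      by (intro G_iter_tail[where b = b] expansionD(3)[OF x]) auto
    moreover have "- 1 < x (k + (h + 1))" "x (k + (h + 1)) < R"
      using strict[of "k + h"] R_less_1 by auto
    \<comment> \<open>Strictness matters: from the endpoint \<open>R\<close> a run of
      \<open>h + 1\<close> ones leads exactly to \<open>- R\<close>, which is an allowed
      value.\<close>
    ultimately have "x k < - R" using G_iter_less[of "x (k + (h + 1))" R "h + 1"] G_iter_R(1) by simp
    moreover have "\<bar>x k\<bar> \<le> R" by (rule expansionD(2)[OF x])
    ultimately show False by linarith
  qed
  have two: "\<exists>i<h. b (Suc k + h + 1 + i) \<noteq> 1"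
    if x: "expansion b x" and strict: "\<And>k. \<bar>x (Suc k)\<bar> < R"
      and b: "0 < b k" "\<forall>i<h. b (Suc k + i) = 1" "b (Suc k + h) = 2" for b x k
  proof (rule ccontr)
    assume neg: "\<not> ?thesis"
    define m where "m = Suc k + h + 1"
    have xm: "x m = (G ^^ h) (x (m + h))"
      using neg by (intro G_iter_tail[where b = b] expansionD(3)[OF x]) (auto simp: m_def)
    have "- 1 < x (m + h)" "x (m + h) < R"
      using strict[of "k + h + h + 1"] R_less_1 by (auto simp: m_def)
    \<comment> \<open>A second run of \<open>h\<close> ones puts the value below
      \<open>p1 = (G ^^ h) R\<close>. The preceding 2 and \<open>h\<close> ones carry
      \<open>p1\<close> to \<open>r\<close>, so the value after the positive digit falls below
      \<open>r\<close>.\<close>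
    then have "x m < p1" using G_iter_less[of "x (m + h)" R h] G_iter_R(2) xm by simp
    moreover have m: "r \<le> x m" "x (Suc k + h) = mob 2 (x m)"
      using expansionD(3,4)[OF x, of "Suc k + h"] b(3) by (simp_all add: m_def)
    ultimately have "mob 2 (x m) < mob 2 p1"
      using r_bounds lam_gt_1 p1_bounds by (subst mob_less_cancel) auto
    then have "(G ^^ h) (x (Suc k + h)) < r"
      using G_iter_less[OF mob_2_bounds(1)[OF m(1)], of "mob 2 p1" h] m G_iter_mob_2_p1 by simp
    moreover have "x (Suc k) = (G ^^ h) (x (Suc k + h))"
      using b by (intro G_iter_tail[where b = b] expansionD(3)[OF x]) auto
    moreover have "r \<le> x (Suc k)" using expansionD(4)[OF x b(1)] .
    ultimately show False by simp
  qed
  have nz: "b i \<noteq> 0" for i by (rule expansionD(1)[OF x])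
  \<comment> \<open>Blocks of negative digits are handled as blocks of \<open>- b\<close> with the
    values \<open>- x\<close>.\<close>
  have s: "\<bar>x (Suc k)\<bar> < R" "\<bar>(- x) (Suc k)\<bar> < R" for k using strict nz by auto
  have e: "- b i = 1 \<longleftrightarrow> b i = - 1" "- b i = 2 \<longleftrightarrow> b i = - 2" for i by linarith+
  show ?thesis unfolding dual_regular_iff
    using nz ones[OF x s(1)] two[OF x s(1)]
      ones[OF expansion_uminus[OF x] s(2)] two[OF expansion_uminus[OF x] s(2)]
    by (simp add: e)
qed

text \<open>The tails of the periodic sequence, by position \<open>i\<close> in the period of length
  \<open>2 * h + 1\<close>: up to \<open>h\<close> there are \<open>h - i\<close> ones before a 2
  with tail \<open>p1\<close>, later there are \<open>2 * h - i\<close> ones before a 2 with tail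
  \<open>r\<close>.\<close>

definition r_orbit :: "nat \<Rightarrow> real" where
  "r_orbit k = (let i = k mod (Suc (2 * h)) in
     if i \<le> h then (G ^^ (h - i)) (mob 2 p1) else (G ^^ (2 * h - i)) (mob 2 r))"

lemma r_seq_eq: "r_seq q k = (if k mod (Suc (2 * h)) \<in> {h, 2 * h} then 2 else 1)"
proof -
  have len: "length (r_period q) = Suc (2 * h)" using h_pos by (simp add: r_period_def)
  define i where "i = k mod (Suc (2 * h))"
  have "i < Suc (2 * h)" unfolding i_def by simp
  then consider "i < h" | "i = h" | "h < i" "i < 2 * h" | "i = 2 * h" by linarith
  then show ?thesis unfolding r_seq_def len i_def[symmetric]
    by cases (use h_pos in \<open>auto simp: r_period_def nth_append nth_Cons'\<close>)
qed

text \<open>The identities \<open>(G ^^ (h - 1)) (mob 2 r) = p1\<close> and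
  \<open>(G ^^ h) (mob 2 p1) = r\<close> close the cycle; the bounds hold because the iterates of
  \<open>G\<close> decrease.\<close>

lemma r_orbit_expansion: "expansion (r_seq q) r_orbit"
  and r_orbit_neg: "r_orbit k < 0"
  and r_orbit_0: "r_orbit 0 = r"
proof -
  have bd: "r \<le> r_orbit k \<and> r_orbit k < 0" for k
  proof -
    define i where "i = k mod (Suc (2 * h))"
    have i: "i \<le> 2 * h" unfolding i_def using mod_less_divisor[of "Suc (2 * h)" k] by linarith
    have rp: "r \<le> p1" using p1_bounds by simp
    show ?thesis
    proof (cases "i \<le> h")
      case True
      have "(G ^^ h) (mob 2 p1) \<le> (G ^^ (h - i)) (mob 2 p1)"
        "(G ^^ (h - i)) (mob 2 p1) \<le> (G ^^ 0) (mob 2 p1)"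
        using mob_2_bounds(1)[OF rp] by (intro G_iter_antimono; simp)+
      then show ?thesis
        using True G_iter_mob_2_p1 mob_2_bounds(3)[OF rp] by (simp add: r_orbit_def flip: i_def)
    next
      case False
      have "(G ^^ (h - 1)) (mob 2 r) \<le> (G ^^ (2 * h - i)) (mob 2 r)"
        "(G ^^ (2 * h - i)) (mob 2 r) \<le> (G ^^ 0) (mob 2 r)"
        using mob_2_bounds(1)[of r] False i by (intro G_iter_antimono; simp)+
      then show ?thesis
        using False G_iter_mob_2_r mob_2_bounds(3)[of r] rp
        by (simp add: r_orbit_def flip: i_def)
    qed
  qed
  then show "r_orbit k < 0" by blast
  show "r_orbit 0 = r" by (simp add: r_orbit_def G_iter_mob_2_p1)
  have rec: "r_orbit k = mob (r_seq q k) (r_orbit (Suc k))" for k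
  proof -
    define i where "i = k mod (Suc (2 * h))"
    have i: "i \<le> 2 * h" unfolding i_def using mod_less_divisor[of "Suc (2 * h)" k] by linarith
    have S: "Suc k mod (Suc (2 * h)) = (if i = 2 * h then 0 else Suc i)"
      unfolding i_def by (simp add: mod_Suc)
    consider "i < h" | "i = h" | "h < i" "i < 2 * h" | "i = 2 * h" using i by linarith
    then show ?thesis
    proof cases
      case 1
      then have "h - i = Suc (h - Suc i)" by simp
      then show ?thesis using 1 S by (simp add: r_orbit_def r_seq_eq flip: i_def)
    next
      case 2
      then have "r_orbit (Suc k) = p1"
        using h_pos S G_iter_mob_2_r(2) by (simp add: r_orbit_def)
      then show ?thesis using 2 by (simp add: r_orbit_def r_seq_eq flip: i_def)
    next
      case 3
      then have "2 * h - i = Suc (2 * h - Suc i)" by simp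
      then show ?thesis using 3 S by (simp add: r_orbit_def r_seq_eq flip: i_def)
    next
      case 4
      then show ?thesis
        using h_pos S G_iter_mob_2_p1 by (simp add: r_orbit_def r_seq_eq flip: i_def)
    qed
  qed
  show "expansion (r_seq q) r_orbit"
  proof (rule expansionI)
    fix k
    show "r_orbit k = mob (r_seq q k) (r_orbit (Suc k))" by (rule rec)
    show "\<bar>r_orbit k\<bar> \<le> R" using bd[of k] r_bounds by linarith
    show "r_seq q k \<noteq> 0" by (simp add: r_seq_eq)
    show "r \<le> r_orbit (Suc k)" using bd by blast
    show "r_orbit (Suc k) \<le> - r" if "r_seq q k < 0"
      using that by (simp add: r_seq_eq split: if_splits)
  qed
qed

lemma r_seq_dual_regular: "r_seq q \<in> dual_regular q"
proof (rule expansion_imp_dual_regular[OF r_orbit_expansion])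
  fix k
  have "r \<le> r_orbit (Suc k)" using expansionD(4)[OF r_orbit_expansion, of k] by (simp add: r_seq_eq)
  then show "\<bar>r_orbit (Suc k)\<bar> < R" using r_orbit_neg[of "Suc k"] r_bounds by linarith
qed

text \<open>The limit of the periodic fraction is the algebraic number used so far, because
  \<open>r_orbit\<close> is an expansion of its regular digits starting at \<open>r\<close>.\<close>

lemma r_val_eq: "r_val q = r"
  unfolding r_val_def
  using rosen_cf_eq[OF r_seq_dual_regular r_orbit_expansion] by (simp add: r_orbit_0)

lemma R_val_eq: "R_val q = R"
  by (simp add: R_val_def r_val_eq r_def)

subsection \<open>The dual map and its coding\<close>

text \<open>As \<open>R - r = lam\<close>, the half-open intervals tile the line, which makes the
  definite description well defined.\<close>

lemma dual_nearest_nonneg_eq: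
  assumes "of_int n * lam + r \<le> y" "y < of_int n * lam + R"
  shows "dual_nearest_nonneg q y = n"
  unfolding dual_nearest_nonneg_def r_val_eq R_val_eq
proof (rule the_equality)
  show "of_int n * lam + r \<le> y \<and> y < of_int n * lam + R" using assms by simp
  fix m assume m: "of_int m * lam + r \<le> y \<and> y < of_int m * lam + R"
  have "of_int n * lam < of_int (m + 1) * lam" "of_int m * lam < of_int (n + 1) * lam"
    using m assms r_bounds(5) by (simp_all add: algebra_simps)
  then have "n < m + 1" "m < n + 1"
    using lam_gt_1 by (simp_all del: of_int_add)
  then show "m = n" by simp
qed

lemma dual_nearest_nonneg_bounds:
  "of_int (dual_nearest_nonneg q y) * lam + r \<le> y"
  "y < of_int (dual_nearest_nonneg q y) * lam + R"
proof -
  define n where "n = \<lfloor>(y - r) / lam\<rfloor>"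
  have "of_int n \<le> (y - r) / lam" "(y - r) / lam < of_int n + 1"
    unfolding n_def by linarith+
  then have n: "of_int n * lam + r \<le> y" "y < of_int n * lam + R"
    using lam_gt_1 r_bounds(5) by (simp_all add: field_simps)
  with dual_nearest_nonneg_eq[OF n]
  show "of_int (dual_nearest_nonneg q y) * lam + r \<le> y"
    "y < of_int (dual_nearest_nonneg q y) * lam + R" by simp_all
qed

lemma dual_nearest_uminus: "y \<noteq> 0 \<Longrightarrow> dual_nearest q (- y) = - dual_nearest q y"
  by (auto simp: dual_nearest_def)

lemma dual_map_uminus: "dual_map q (- y) = - dual_map q y"
  using dual_nearest_uminus[of "- (1 / y)"] by (simp add: dual_map_def)

lemma dual_map_neg:
  assumes "- R \<le> y" "y < 0" and c: "c = dual_nearest q (- 1 / y)"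
  shows "0 < c" "y = mob c (dual_map q y)" "r \<le> dual_map q y" "dual_map q y < R"
proof -
  have y: "0 < - 1 / y" using assms by simp
  then have c': "c = dual_nearest_nonneg q (- 1 / y)" by (simp add: c dual_nearest_def)
  have f: "dual_map q y = - 1 / y - of_int c * lam" using assms by (simp add: dual_map_def)
  show "r \<le> dual_map q y" "dual_map q y < R"
    using dual_nearest_nonneg_bounds[of "- 1 / y"] by (simp_all add: f c')
  show "y = mob c (dual_map q y)" using assms(2) by (simp add: mob_def f)
  \<comment> \<open>The digit 0 is excluded: \<open>- 1 / y\<close> is at least
    \<open>1 / R = 2 + r\<close>, which exceeds \<open>lam + r = R\<close>.\<close>
  have "1 / R \<le> - 1 / y" using assms R_pos by (simp add: divide_simps)
  then have "R < - 1 / y" using inverse_R lam_less_2 r_bounds by linarith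
  moreover have "of_int c * lam \<le> 0" if "c \<le> 0"
    using that lam_gt_1 by (simp add: mult_nonpos_nonneg)
  ultimately show "0 < c" using \<open>dual_map q y < R\<close> f by linarith
qed

lemma dual_map_step:
  assumes "\<bar>y\<bar> \<le> R" "y \<noteq> 0" and c: "c = dual_nearest q (- 1 / y)"
  shows "c \<noteq> 0" "y = mob c (dual_map q y)" "\<bar>dual_map q y\<bar> < R"
    "0 < c \<Longrightarrow> r \<le> dual_map q y" "c < 0 \<Longrightarrow> dual_map q y \<le> - r"
proof -
  have "c \<noteq> 0 \<and> y = mob c (dual_map q y) \<and> \<bar>dual_map q y\<bar> < R \<and>
    (0 < c \<longrightarrow> r \<le> dual_map q y) \<and> (c < 0 \<longrightarrow> dual_map q y \<le> - r)"
  proof (cases "y < 0")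
    case True
    then show ?thesis using dual_map_neg[OF _ True c] assms(1) r_bounds by auto
  next
    case False
    then have y: "- R \<le> - y" "- y < 0" using assms by auto
    have c': "- c = dual_nearest q (- 1 / (- y))"
      using dual_nearest_uminus[of "- 1 / y"] assms by simp
    note D = dual_map_neg[OF y c', unfolded dual_map_uminus]
    have "y = mob c (dual_map q y)" using D(2) by (simp add: mob_minus)
    then show ?thesis using D(1,3,4) r_bounds by auto
  qed
  then show "c \<noteq> 0" "y = mob c (dual_map q y)" "\<bar>dual_map q y\<bar> < R"
    "0 < c \<Longrightarrow> r \<le> dual_map q y" "c < 0 \<Longrightarrow> dual_map q y \<le> - r" by blast+
qed

lemma dual_map_mob_pos:
  assumes "0 < c" "r \<le> t" "t < R"
  shows "mob c t < 0" "dual_nearest q (- 1 / mob c t) = c" "dual_map q (mob c t) = t"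
proof -
  have "0 < of_int c * lam + t" using denom_pos[of c t] assms r_bounds by auto
  then show "mob c t < 0" and n: "dual_nearest q (- 1 / mob c t) = c"
    using assms by (simp_all add: mob_def dual_nearest_def dual_nearest_nonneg_eq)
  then show "dual_map q (mob c t) = t" by (simp add: dual_map_def) (simp add: mob_def)
qed

text \<open>\<open>mob c\<close> is an inverse branch of the dual map. The endpoint \<open>R\<close>
  is left out because there the dual map would choose \<open>c + 1\<close> in place of a positive
  \<open>c\<close>.\<close>

lemma dual_map_mob:
  assumes "c \<noteq> 0" "\<bar>t\<bar> < R" "0 < c \<Longrightarrow> r \<le> t" "c < 0 \<Longrightarrow> t \<le> - r"
  shows "mob c t \<noteq> 0" "dual_nearest q (- 1 / mob c t) = c" "dual_map q (mob c t) = t"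
proof -
  have "mob c t \<noteq> 0 \<and> dual_nearest q (- 1 / mob c t) = c \<and> dual_map q (mob c t) = t"
  proof (cases "0 < c")
    case True
    moreover have "t < R" using assms(2) by linarith
    ultimately show ?thesis using dual_map_mob_pos[of c t] assms(3) by auto
  next
    case False
    then have "0 < - c" "r \<le> - t" "- t < R" using assms by auto
    note D = dual_map_mob_pos[OF this, unfolded mob_minus dual_map_uminus]
    have "dual_nearest q (- 1 / mob c t) = c"
      using D(1,2) dual_nearest_uminus[of "- 1 / mob c t"] by simp
    then show ?thesis using D(1,3) by simp
  qed
  then show "mob c t \<noteq> 0" "dual_nearest q (- 1 / mob c t) = c" "dual_map q (mob c t) = t"
    by blast+
qed

lemma dual_J_pos_iff:
  assumes "0 < c" "- R \<le> y"
  shows "y \<in> dual_J_pos q c \<longleftrightarrow> y < 0 \<and> of_int c * lam + r \<le> - 1 / y \<and> - 1 / y \<le> of_int c * lam + R"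
proof -
  have pos: "0 < of_int d * lam + r" if "0 < d" for d using denom_pos[OF that, of r] r_bounds by simp
  have up: "y \<le> - 1 / B \<longleftrightarrow> y < 0 \<and> - 1 / y \<le> B" if "0 < B" for B
  proof (cases "y < 0")
    case False
    then have "- 1 / B < y" using that by (simp add: order.strict_trans2[of _ 0])
    then show ?thesis using False by simp
  qed (use that in \<open>auto simp: divide_simps mult.commute\<close>)
  have low: "- 1 / A \<le> y \<longleftrightarrow> A \<le> - 1 / y" if "0 < A" "y < 0" for A
    using that by (auto simp: divide_simps mult.commute)
  have e: "of_int (c + 1) * lam + r = of_int c * lam + R" using r_bounds(5) by (simp add: algebra_simps)
  show ?thesis
  proof (cases "c = 1")
    case True
    \<comment> \<open>The first interval starts at \<open>- R\<close> and not at
      \<open>- 1 / (lam + r)\<close>; the lower bound on \<open>- 1 / y\<close> then holds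
      automatically, as \<open>1 / R = 2 + r > lam + r\<close>.\<close>
    have "lam + r \<le> - 1 / y" if "y < 0"
    proof -
      have "1 / R \<le> - 1 / y" using assms that R_pos by (simp add: divide_simps)
      then show ?thesis using inverse_R lam_less_2 by linarith
    qed
    then show ?thesis
      using True assms up[OF pos[of 2]] e by (auto simp: dual_J_pos_def r_val_eq R_val_eq add.commute)
  next
    case False
    have "y \<in> dual_J_pos q c \<longleftrightarrow>
        - 1 / (of_int c * lam + r) \<le> y \<and> y \<le> - 1 / (of_int (c + 1) * lam + r)"
      using False by (simp add: dual_J_pos_def r_val_eq add.commute)
    then show ?thesis
      using up[OF pos[of "c + 1"]] low[OF pos[OF assms(1)]] assms e by auto
  qed
qed

text \<open>Neighbouring closed intervals meet only in an endpoint, where the remainder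
  \<open>R\<close> for \<open>c\<close> is the remainder \<open>r\<close> for \<open>c + 1\<close>.
  The dual map sends this point to \<open>r\<close>, which is excluded.\<close>

lemma dual_J_pos_iff_nearest:
  assumes "0 < c" "- R \<le> y" "y < 0" "dual_map q y \<noteq> r"
  shows "y \<in> dual_J_pos q c \<longleftrightarrow> c = dual_nearest q (- 1 / y)"
proof
  assume "c = dual_nearest q (- 1 / y)"
  then have "r \<le> dual_map q y" "dual_map q y < R" "dual_map q y = - 1 / y - of_int c * lam"
    using dual_map_neg[OF assms(2,3)] assms(3) by (auto simp: dual_map_def)
  then show "y \<in> dual_J_pos q c" using dual_J_pos_iff[OF assms(1,2)] assms(3) by linarith
next
  assume "y \<in> dual_J_pos q c"
  then have t: "r \<le> - 1 / y - of_int c * lam" "- 1 / y - of_int c * lam \<le> R"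
    using dual_J_pos_iff[OF assms(1,2)] by auto
  have "- 1 / y - of_int c * lam \<noteq> R"
  proof
    assume "- 1 / y - of_int c * lam = R"
    then have "- 1 / y = of_int (c + 1) * lam + r" using r_bounds(5) by (simp add: algebra_simps)
    then have "- 1 / (- 1 / y) = mob (c + 1) r" unfolding mob_def by (rule arg_cong)
    then have "y = mob (c + 1) r" by simp
    then show False using dual_map_mob_pos(3)[of "c + 1" r] assms r_bounds by simp
  qed
  moreover have "y = mob c (- 1 / y - of_int c * lam)" using assms(3) by (simp add: mob_def)
  ultimately show "c = dual_nearest q (- 1 / y)"
    using dual_map_mob_pos(2)[of c "- 1 / y - of_int c * lam"] assms(1) t by simp
qed

lemma dual_J_iff_nearest:
  assumes "\<bar>y\<bar> \<le> R" "y \<noteq> 0" "dual_map q y \<noteq> r" "dual_map q y \<noteq> - r"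
  shows "y \<in> dual_J q c \<longleftrightarrow> c = dual_nearest q (- 1 / y)"
proof -
  define d where "d = dual_nearest q (- 1 / y)"
  have J_neg: "z < 0" if "0 < c" "- R \<le> z" "z \<in> dual_J_pos q c" for c z
    using dual_J_pos_iff[OF that(1,2)] that(3) by blast
  have d_pos: "0 < d" if "y < 0" using dual_map_neg(1)[of y d] that assms by (simp add: d_def)
  have d': "- d = dual_nearest q (- 1 / (- y))"
    using dual_nearest_uminus[of "- 1 / y"] assms by (simp add: d_def)
  have d_neg: "d < 0" if "0 < y" using dual_map_neg(1)[OF _ _ d'] that assms by simp
  consider "0 < c" | "c < 0" | "c = 0" by linarith
  then show ?thesis unfolding d_def[symmetric]
  proof cases
    case 1
    then show "y \<in> dual_J q c \<longleftrightarrow> c = d"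
      using dual_J_pos_iff_nearest[OF 1, of y] J_neg[OF 1, of y] d_neg assms
      by (cases "y < 0") (auto simp: dual_J_def d_def)
  next
    case 2
    have "y \<in> dual_J q c \<longleftrightarrow> - y \<in> dual_J_pos q (- c)"
      using 2 by (auto simp: dual_J_def image_iff) (metis minus_minus)
    also have "\<dots> \<longleftrightarrow> - c = - d"
    proof (cases "0 < y")
      case True
      then show ?thesis
        using dual_J_pos_iff_nearest[of "- c" "- y", folded d'] assms 2
        by (simp add: dual_map_uminus minus_equation_iff[of _ r])
    next
      case False
      then show ?thesis using J_neg[of "- c" "- y"] d_pos assms 2 by auto
    qed
    finally show "y \<in> dual_J q c \<longleftrightarrow> c = d" by simp
  next
    case 3
    then show "y \<in> dual_J q c \<longleftrightarrow> c = d"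
      using d_pos d_neg assms(2) by (cases "y < 0") (auto simp: dual_J_def)
  qed
qed

section \<open>Digits forced by the value of an expansion\<close>

lemma expansion_forced:
  assumes x: "expansion b x" and "0 < c" "r \<le> t" "t \<le> R" "x k = mob c t"
  shows "0 < b k" "of_int (b k) * lam + x (Suc k) = of_int c * lam + t"
    "r \<le> x (Suc k)" "x (Suc k) \<le> R"
proof -
  have c: "0 < of_int c * lam + t" using denom_pos[of c t] assms r_bounds by simp
  have "mob (b k) (x (Suc k)) = mob c t" using expansionD(3)[OF x, of k] assms(5) by simp
  then show e: "of_int (b k) * lam + x (Suc k) = of_int c * lam + t"
    using denom_nonzero[OF expansionD(1)[OF x] expansionD(2)[OF x], of k "Suc k"] c unfolding mob_def
    by (simp add: field_simps)
  show "0 < b k"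
  proof (rule ccontr)
    assume "\<not> 0 < b k"
    then have "0 < - b k" using expansionD(1)[OF x, of k] by simp
    from denom_pos[OF this, of "- x (Suc k)"] show False
      using expansionD(2)[OF x, of "Suc k"] e c by simp
  qed
  then show "r \<le> x (Suc k)" by (rule expansionD(4)[OF x])
  show "x (Suc k) \<le> R" using expansionD(2)[OF x, of "Suc k"] by simp
qed

text \<open>Both remainders lie in \<open>[r, R]\<close>, of length \<open>lam\<close>, and
  \<open>t\<close> is interior, so they differ by less than \<open>lam\<close> and the digits
  agree.\<close>

lemma expansion_forced_interior:
  assumes x: "expansion b x" and "0 < c" "r < t" "t < R" "x k = mob c t"
  shows "b k = c" "x (Suc k) = t"
proof -
  note F = expansion_forced[OF x assms(2) _ _ assms(5)]
  have "of_int (b k) * lam < of_int (c + 1) * lam" "of_int c * lam < of_int (b k + 1) * lam"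
    using F assms(3,4) r_bounds(5) by (simp_all add: algebra_simps)
  then have "b k < c + 1" "c < b k + 1" using lam_gt_1 by (simp_all del: of_int_add)
  then show "b k = c" by simp
  then show "x (Suc k) = t" using F assms by simp
qed

text \<open>The denominator \<open>2 * lam + r = lam + R\<close> is the common endpoint of the
  ranges for the digits 2 and 1.\<close>

lemma expansion_forced_boundary:
  assumes x: "expansion b x" and "x k = mob 2 r"
  shows "b k = 2 \<and> x (Suc k) = r \<or> b k = 1 \<and> x (Suc k) = R"
proof -
  have F: "0 < b k" "of_int (b k) * lam + x (Suc k) = 2 * lam + r"
    "r \<le> x (Suc k)" "x (Suc k) \<le> R"
    using expansion_forced[OF x _ _ _ assms(2)] r_bounds by simp_all
  have "b k \<le> 2"
  proof (rule ccontr)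
    assume "\<not> b k \<le> 2"
    then have "3 * lam \<le> of_int (b k) * lam" using lam_gt_1 by (intro mult_right_mono) auto
    then show False using F r_bounds by linarith
  qed
  then have "b k = 1 \<or> b k = 2" using F r_bounds by linarith
  then show ?thesis using F r_bounds by auto
qed

lemma expansion_forced_run:
  assumes x: "expansion b x" and "\<And>i. i < j \<Longrightarrow> r < (G ^^ i) t \<and> (G ^^ i) t < R"
    and "x k = (G ^^ j) t"
  shows "(\<forall>i<j. b (k + i) = 1) \<and> x (k + j) = t"
  using assms(2,3)
proof (induction j arbitrary: k)
  case (Suc j)
  then have k: "b k = 1" "x (Suc k) = (G ^^ j) t"
    using expansion_forced_interior[OF x, of 1 "(G ^^ j) t" k] by auto
  then have "(\<forall>i<j. b (Suc k + i) = 1) \<and> x (Suc k + j) = t"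
    using Suc.IH[OF _ k(2)] Suc.prems(1) less_SucI by blast
  then show ?case using k by (auto simp: less_Suc_eq_0_disj)
qed simp

lemma G_iter_mob_2_r_interior:
  assumes "i < h" shows "r < (G ^^ i) (mob 2 r)" "(G ^^ i) (mob 2 r) < R"
proof -
  have "(G ^^ (h - 1)) (mob 2 r) \<le> (G ^^ i) (mob 2 r)" "(G ^^ i) (mob 2 r) \<le> (G ^^ 0) (mob 2 r)"
    using mob_2_bounds(1)[of r] assms by (intro G_iter_antimono; simp)+
  then show "r < (G ^^ i) (mob 2 r)" "(G ^^ i) (mob 2 r) < R"
    using G_iter_mob_2_r(2) p1_bounds mob_2_bounds(3)[of r] R_pos by auto
qed

lemma G_iter_mob_2_p1_interior:
  assumes "i < h" shows "r < (G ^^ i) (mob 2 p1)" "(G ^^ i) (mob 2 p1) < R"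
proof -
  have p: "r \<le> p1" using p1_bounds by simp
  \<comment> \<open>Comparing with the iterate \<open>Suc i\<close> leaves room for one strict
    decrease, since \<open>(G ^^ h) (mob 2 p1)\<close> is \<open>r\<close> itself.\<close>
  have "(G ^^ h) (mob 2 p1) \<le> (G ^^ Suc i) (mob 2 p1)" "(G ^^ i) (mob 2 p1) \<le> (G ^^ 0) (mob 2 p1)"
    using mob_2_bounds(1)[OF p] assms by (intro G_iter_antimono; simp)+
  then show "r < (G ^^ i) (mob 2 p1)" "(G ^^ i) (mob 2 p1) < R"
    using G_iter_mob_2_p1 G_iter_Suc_less[OF mob_2_bounds(1)[OF p], of i] assms
      mob_2_bounds(3)[OF p] R_pos by auto
qed

text \<open>From \<open>- R = (G ^^ h) (mob 2 r)\<close> the first \<open>h\<close> digits are ones;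
  choosing 1 once more would complete a forbidden run.\<close>

lemma expansion_minus_R:
  assumes reg: "b \<in> dual_regular q" and x: "expansion b x" and "x k = - R"
  shows "b (k + h) = 2" "x (Suc (k + h)) = r"
proof -
  have run: "\<forall>i<h. b (k + i) = 1" "x (k + h) = mob 2 r"
    using expansion_forced_run[OF x, of h "mob 2 r" k] G_iter_mob_2_r_interior
      G_iter_mob_2_r(1) assms(3) by auto
  have "b (k + h) \<noteq> 1"
    using dual_regular_ones[OF reg, of k] run(1) by (metis le_neq_implies_less)
  then show "b (k + h) = 2" "x (Suc (k + h)) = r"
    using expansion_forced_boundary[OF x run(2)] by auto
qed

text \<open>All remainders met before the place \<open>2 * h + 1\<close> are interior to
  \<open>[r, R]\<close>, which forces the digits; at the place \<open>2 * h\<close> the value is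
  \<open>mob 2 r\<close>, with its two continuations.\<close>

lemma expansion_r:
  assumes x: "expansion b x" and "x k = r"
  shows "\<forall>i<2 * h. b (k + i) = r_seq q i"
    and "b (k + 2 * h) = 2 \<and> x (Suc (k + 2 * h)) = r \<or> b (k + 2 * h) = 1 \<and> x (Suc (k + 2 * h)) = R"
proof -
  have run: "\<forall>i<h. b (k + i) = 1" "x (k + h) = mob 2 p1"
    using expansion_forced_run[OF x, of h "mob 2 p1" k] G_iter_mob_2_p1_interior
      G_iter_mob_2_p1 assms(2) by auto
  have mid: "b (k + h) = 2" "x (Suc (k + h)) = p1"
    using expansion_forced_interior[OF x _ _ _ run(2)] p1_bounds by auto
  have run2: "\<forall>i<h - 1. b (Suc (k + h) + i) = 1" "x (Suc (k + h) + (h - 1)) = mob 2 r"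
    using expansion_forced_run[OF x, of "h - 1" "mob 2 r" "Suc (k + h)"] G_iter_mob_2_r_interior
      G_iter_mob_2_r(2) mid(2) by auto
  show "\<forall>i<2 * h. b (k + i) = r_seq q i"
  proof (intro allI impI)
    fix i assume i: "i < 2 * h"
    consider "i < h" | "i = h" | "h < i" by linarith
    then show "b (k + i) = r_seq q i"
    proof cases
      case 3
      then have "i - Suc h < h - 1" "Suc (k + h) + (i - Suc h) = k + i" using i by simp_all
      then have "b (k + i) = 1" using run2(1) by metis
      then show ?thesis using 3 i by (simp add: r_seq_eq)
    qed (use run mid i in \<open>auto simp: r_seq_eq\<close>)
  qed
  have e: "Suc (k + h) + (h - 1) = k + 2 * h" using h_pos by simp
  then show "b (k + 2 * h) = 2 \<and> x (Suc (k + 2 * h)) = r \<or>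
      b (k + 2 * h) = 1 \<and> x (Suc (k + 2 * h)) = R"
    using expansion_forced_boundary[OF x run2(2)] by (simp only: e)
qed

lemma seq_shift_funpow: "(seq_shift ^^ n) b = (\<lambda>i. b (n + i))"
  by (induction n) (auto simp: seq_shift_def)

lemma has_r_tail_uminus: "has_r_tail q (- b) \<longleftrightarrow> has_r_tail q b"
proof -
  have "(\<lambda>i. - b (n + i)) = r_seq q \<longleftrightarrow> (\<lambda>i. b (n + i)) = (\<lambda>i. - r_seq q i)"
    "(\<lambda>i. - b (n + i)) = (\<lambda>i. - r_seq q i) \<longleftrightarrow> (\<lambda>i. b (n + i)) = r_seq q" for n
    by (auto simp: fun_eq_iff minus_equation_iff)
  then show ?thesis unfolding has_r_tail_def seq_shift_funpow by auto
qed

lemma expansion_r_after_pos: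
  assumes reg: "b \<in> dual_regular q" and x: "expansion b x" and k: "0 < b k" "x (Suc k) = r"
  shows "(\<lambda>i. b (Suc k + i)) = r_seq q"
proof -
  have period: "(\<forall>i\<le>2 * h. b (Suc k + i) = r_seq q i) \<and> x (Suc k + Suc (2 * h)) = r"
    if k: "0 < b k" "x (Suc k) = r" for k
  proof -
    note E = expansion_r[OF x k(2)]
    \<comment> \<open>The digit 1 at this place would complete the second run of \<open>h\<close>
      ones, hence the long forbidden block after the positive digit \<open>b k\<close>.\<close>
    have "b (Suc k + 2 * h) \<noteq> 1"
    proof
      assume last: "b (Suc k + 2 * h) = 1"
      have "b (Suc k + i) = 1" if "i < h" for i using E(1) that by (simp add: r_seq_eq)
      moreover have "b (Suc k + h) = 2" using E(1) h_pos by (simp add: r_seq_eq)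
      ultimately obtain i where i: "i < h" "b (Suc k + h + 1 + i) \<noteq> 1"
        using dual_regular_two[OF reg k(1)] by blast
      show False
      proof (cases "i = h - 1")
        case True
        then have "Suc k + h + 1 + i = Suc k + 2 * h" using h_pos by simp
        then show False using i(2) last by metis
      next
        case False
        have "b (Suc k + (h + 1 + i)) = r_seq q (h + 1 + i)"
          using E(1)[rule_format, of "h + 1 + i"] i False by linarith
        moreover have "Suc i \<noteq> h" using False by simp
        ultimately show False using i by (simp add: r_seq_eq add.assoc)
      qed
    qed
    then have "b (Suc k + 2 * h) = 2" "x (Suc k + Suc (2 * h)) = r" using E(2) by auto
    moreover have "r_seq q (2 * h) = 2" by (simp add: r_seq_eq)
    ultimately show ?thesis using E(1) by (auto simp: le_less)
  qed
  \<comment> \<open>The 2 that ends a period is the positive digit required before the next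
    one.\<close>
  have iter: "0 < b (k + n * Suc (2 * h)) \<and> x (Suc (k + n * Suc (2 * h))) = r" for n
  proof (induction n)
    case (Suc n)
    have "Suc (k + n * Suc (2 * h)) + 2 * h = k + Suc n * Suc (2 * h)"
      "Suc (k + n * Suc (2 * h)) + Suc (2 * h) = Suc (k + Suc n * Suc (2 * h))" by simp_all
    then have "b (k + Suc n * Suc (2 * h)) = r_seq q (2 * h)"
      "x (Suc (k + Suc n * Suc (2 * h))) = r"
      using period[of "k + n * Suc (2 * h)"] Suc by (metis order_refl)+
    moreover have "0 < r_seq q (2 * h)" by (simp add: r_seq_eq)
    ultimately show ?case by (simp only:)
  qed (use k in simp)
  show ?thesis
  proof
    fix i
    define n m where "n = i div Suc (2 * h)" and "m = i mod Suc (2 * h)"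
    have "m \<le> 2 * h" unfolding m_def using mod_less_divisor[of "Suc (2 * h)" i] by linarith
    then have "b (Suc (k + n * Suc (2 * h)) + m) = r_seq q m"
      using period[of "k + n * Suc (2 * h)"] iter[of n] by blast
    moreover have "Suc (k + n * Suc (2 * h)) + m = Suc k + i" unfolding n_def m_def
      using div_mult_mod_eq[of i "Suc (2 * h)"] by linarith
    moreover have "r_seq q m = r_seq q i" by (simp add: m_def r_seq_eq del: mult_Suc_right)
    ultimately show "b (Suc k + i) = r_seq q i" by metis
  qed
qed

text \<open>The digits of an expansion of \<open>-R\<close> or \<open>r\<close> are forced until a tail \<open>r\<close> or \<open>R\<close> is
  reached, where \<open>mob 2 r = mob 1 R\<close> leaves a choice; the second option is either excluded by
  regularity or leads to the tail \<open>-r\<close>.\<close>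

lemma expansion_boundary_imp_tail:
  assumes reg: "b \<in> dual_regular q" and x: "expansion b x" and k: "\<bar>x k\<bar> \<in> {- r, R}"
  shows "has_r_tail q b"
proof -
  have after_pos: "has_r_tail q b"
    if "b \<in> dual_regular q" "expansion b x" "0 < b k" "x (Suc k) = r" for b x k
    using expansion_r_after_pos[OF that] unfolding has_r_tail_def seq_shift_funpow by blast
  have minus_R: "has_r_tail q b"
    if "b \<in> dual_regular q" "expansion b x" "x k = - R" for b x k
    using expansion_minus_R[OF that] after_pos[OF that(1,2), of "k + h"] by simp
  have R: "has_r_tail q b"
    if "b \<in> dual_regular q" "expansion b x" "x k = R" for b x k
    using minus_R[OF dual_regular_uminus expansion_uminus, OF that(1,2), of k] that(3)
    by (simp add: has_r_tail_uminus)
  have r: "has_r_tail q b"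
    if "b \<in> dual_regular q" "expansion b x" "x k = r" for b x k
    using expansion_r(2)[OF that(2,3)] after_pos[OF that(1,2), of "k + 2 * h"]
      R[OF that(1,2), of "Suc (k + 2 * h)"] by auto
  have minus_r: "has_r_tail q b"
    if "b \<in> dual_regular q" "expansion b x" "x k = - r" for b x k
    using r[OF dual_regular_uminus expansion_uminus, OF that(1,2), of k] that(3)
    by (simp add: has_r_tail_uminus)
  have "x k = R \<or> x k = - R \<or> x k = r \<or> x k = - r" using k by auto
  then show ?thesis using R minus_R r minus_r reg x by blast
qed

section \<open>Digits of the dual map and their values\<close>

definition digits :: "real \<Rightarrow> nat \<Rightarrow> int" where
  "digits y i = dual_nearest q (- 1 / (dual_map q ^^ i) y)"

lemma dom_iff:
  "y \<in> I_R q - dual_boundary q \<longleftrightarrow> \<bar>y\<bar> \<le> R \<and>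
    (\<forall>n. (dual_map q ^^ n) y \<noteq> r \<and> (dual_map q ^^ n) y \<noteq> - r \<and> (dual_map q ^^ n) y \<noteq> 0)"
  unfolding dual_boundary_def I_R_def r_val_eq R_val_eq by auto

lemma dual_map_dom:
  assumes "y \<in> I_R q - dual_boundary q"
  shows "dual_map q y \<in> I_R q - dual_boundary q"
proof -
  have y: "\<bar>y\<bar> \<le> R" and ne: "(dual_map q ^^ n) y \<noteq> r \<and> (dual_map q ^^ n) y \<noteq> - r \<and> (dual_map q ^^ n) y \<noteq> 0" for n
    using assms unfolding dom_iff by auto
  have "\<bar>dual_map q y\<bar> \<le> R" using dual_map_step(3)[OF y _ refl] ne[of 0] by simp
  moreover have "(dual_map q ^^ n) (dual_map q y) = (dual_map q ^^ Suc n) y" for n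
    by (simp add: funpow_swap1)
  ultimately show ?thesis unfolding dom_iff using ne by presburger
qed

lemma dual_map_funpow_dom:
  "y \<in> I_R q - dual_boundary q \<Longrightarrow> (dual_map q ^^ n) y \<in> I_R q - dual_boundary q"
  by (induction n) (simp_all only: funpow.simps id_apply comp_apply dual_map_dom)

text \<open>The closed intervals overlap only at points sent to \<open>r\<close> or
  \<open>- r\<close>. The next iterate lies in the domain as well, so it avoids these values and
  each digit is the one chosen by the half-open rule.\<close>

lemma is_coding_iff:
  assumes "y \<in> I_R q - dual_boundary q"
  shows "is_coding q y b \<longleftrightarrow> b = digits y"
proof -
  have "(dual_map q ^^ i) y \<in> dual_J q c \<longleftrightarrow> c = digits y i" for i c
  proof -
    have "(dual_map q ^^ i) y \<in> I_R q - dual_boundary q" using dual_map_funpow_dom[OF assms] .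
    moreover have "(dual_map q ^^ Suc i) y \<in> I_R q - dual_boundary q" using dual_map_funpow_dom[OF assms] .
    ultimately have "\<bar>(dual_map q ^^ i) y\<bar> \<le> R" "(dual_map q ^^ i) y \<noteq> 0"
      "dual_map q ((dual_map q ^^ i) y) \<noteq> r" "dual_map q ((dual_map q ^^ i) y) \<noteq> - r"
      unfolding dom_iff by (auto dest: spec[of _ 0])
    from dual_J_iff_nearest[OF this] show ?thesis by (simp add: digits_def)
  qed
  then show ?thesis unfolding is_coding_def fun_eq_iff by simp
qed

lemma coding_eq_digits: "y \<in> I_R q - dual_boundary q \<Longrightarrow> coding q y = digits y"
  unfolding coding_def by (rule the_equality) (use is_coding_iff in blast)+

lemma digits_expansion:
  assumes "y \<in> I_R q - dual_boundary q"
  shows "expansion (digits y) (\<lambda>i. (dual_map q ^^ i) y)"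
    and "\<bar>(dual_map q ^^ Suc i) y\<bar> < R"
proof -
  have y: "\<bar>(dual_map q ^^ k) y\<bar> \<le> R" "(dual_map q ^^ k) y \<noteq> 0" for k
    using dual_map_funpow_dom[OF assms, of k] unfolding dom_iff by (auto dest: spec[of _ 0])
  note step = dual_map_step[OF y digits_def]
  show "expansion (digits y) (\<lambda>i. (dual_map q ^^ i) y)"
    using y(1) step by (intro expansionI) simp_all
  show "\<bar>(dual_map q ^^ Suc i) y\<bar> < R" using step(3) by simp
qed

lemma digits_dual_regular: "y \<in> I_R q - dual_boundary q \<Longrightarrow> digits y \<in> dual_regular q"
  using digits_expansion by (intro expansion_imp_dual_regular) auto

lemma rosen_cf_digits: "y \<in> I_R q - dual_boundary q \<Longrightarrow> rosen_cf q (digits y) = y"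
  using rosen_cf_eq[OF digits_dual_regular digits_expansion(1)] by simp

lemma rosen_cf_in_I_R: "b \<in> dual_regular q \<Longrightarrow> rosen_cf q b \<in> I_R q"
  using rosen_cf_eq[OF _ cf_tail_lim_expansion] expansionD(2)[OF cf_tail_lim_expansion, of b 0]
  by (auto simp: I_R_def R_val_eq)

text \<open>An iterate of \<open>y\<close> is the value of the corresponding tail of digits. The
  tails \<open>r_seq q\<close> and \<open>- r_seq q\<close> have the values \<open>r\<close> and
  \<open>- r\<close>, which no iterate of a point of the domain takes.\<close>

lemma digits_no_tail:
  assumes "y \<in> I_R q - dual_boundary q"
  shows "\<not> has_r_tail q (digits y)"
proof
  assume "has_r_tail q (digits y)"
  then obtain n where n: "(\<lambda>i. digits y (n + i)) = r_seq q \<or> (\<lambda>i. digits y (n + i)) = - r_seq q"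
    unfolding has_r_tail_def seq_shift_funpow by (auto simp: fun_Compl_def)
  have E: "rosen_cf q (\<lambda>i. digits y (n + i)) = (dual_map q ^^ n) y"
    using rosen_cf_eq[OF dual_regular_drop[OF digits_dual_regular]
        expansion_drop[OF digits_expansion(1)], OF assms assms, of n] by simp
  have "rosen_cf q (- r_seq q) = - r"
    using rosen_cf_eq[OF dual_regular_uminus[OF r_seq_dual_regular]
        expansion_uminus[OF r_orbit_expansion]] by (simp add: r_orbit_0)
  moreover have "rosen_cf q (r_seq q) = r" using r_val_eq by (simp add: r_val_def)
  ultimately have "(dual_map q ^^ n) y = r \<or> (dual_map q ^^ n) y = - r" using n E by auto
  then show False using assms unfolding dom_iff by blast
qed

text \<open>Without such a tail no value \<open>x k\<close> is \<open>\<plusminus>r\<close> or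
  \<open>\<plusminus>R\<close>. All values are then strictly inside, so \<open>dual_map\<close>
  undoes each \<open>mob (b k)\<close> and moves from \<open>x k\<close> to
  \<open>x (Suc k)\<close>.\<close>

lemma rosen_cf_dom:
  assumes reg: "b \<in> dual_regular q" and tail: "\<not> has_r_tail q b"
  shows "rosen_cf q b \<in> I_R q - dual_boundary q" "digits (rosen_cf q b) = b"
proof -
  obtain x where x: "expansion b x" using cf_tail_lim_expansion[OF reg] by blast
  have cf: "rosen_cf q b = x 0" by (rule rosen_cf_eq[OF reg x])
  have ne: "\<bar>x k\<bar> \<notin> {- r, R}" for k using expansion_boundary_imp_tail[OF reg x] tail by blast
  have less: "\<bar>x k\<bar> < R" for k using ne[of k] expansionD(2)[OF x, of k] by auto
  have D: "x k \<noteq> 0" "dual_nearest q (- 1 / x k) = b k" "dual_map q (x k) = x (Suc k)" for k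
    using dual_map_mob[of "b k" "x (Suc k)"] expansionD[OF x, of k] less by simp_all
  have iter: "(dual_map q ^^ n) (x 0) = x n" for n by (induction n) (simp_all add: D(3))
  have "x n \<noteq> r \<and> x n \<noteq> - r \<and> x n \<noteq> 0" for n using ne[of n] D(1)[of n] r_bounds(2) by auto
  then show "rosen_cf q b \<in> I_R q - dual_boundary q"
    unfolding cf dom_iff iter using expansionD(2)[OF x, of 0] by blast
  show "digits (rosen_cf q b) = b" unfolding cf by (rule ext) (simp only: digits_def iter D(2))
qed

end

text \<open>Unique existence of a code gives meaning to the definite description in
  \<open>coding\<close>. The extension of the inverse to all regular sequences is expressed by
  convergence with values in \<open>I_R q\<close>, and by agreement with \<open>inv_into\<close> on
  the image.\<close>

theorem lemma4p4p2:
  fixes q :: nat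
  assumes "odd q" and "q \<ge> 5"
  shows
    "(\<forall>x \<in> I_R q - dual_boundary q. \<exists>!b. is_coding q x b) \<and>
     bij_betw (coding q) (I_R q - dual_boundary q)
       (dual_regular q - {b \<in> dual_regular q. has_r_tail q b}) \<and>
     (\<forall>x \<in> I_R q - dual_boundary q.
        dual_map q x \<in> I_R q - dual_boundary q \<and>
        coding q (dual_map q x) = seq_shift (coding q x)) \<and>
     (\<forall>b \<in> dual_regular q. rosen_cf_converges q b \<and> rosen_cf q b \<in> I_R q) \<and>
     (\<forall>b \<in> dual_regular q - {b \<in> dual_regular q. has_r_tail q b}.
        inv_into (I_R q - dual_boundary q) (coding q) b = rosen_cf q b)"
proof -
  interpret rosen_odd q using assms by unfold_locales
  let ?D = "I_R q - dual_boundary q"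
  let ?B = "dual_regular q - {b \<in> dual_regular q. has_r_tail q b}"
  have cf: "rosen_cf q b \<in> ?D" "coding q (rosen_cf q b) = b" if "b \<in> ?B" for b
    using rosen_cf_dom[of b] that coding_eq_digits[of "rosen_cf q b"] by auto
  have dom: "coding q y \<in> ?B" "rosen_cf q (coding q y) = y" if "y \<in> ?D" for y
    using digits_dual_regular[OF that] digits_no_tail[OF that] rosen_cf_digits[OF that]
      coding_eq_digits[OF that] by auto
  \<comment> \<open>The continued fraction value is a two-sided inverse between the two
    sets.\<close>
  have bij: "bij_betw (coding q) ?D ?B"
    by (rule bij_betw_byWitness[where f' = "rosen_cf q"]) (use cf dom in blast)+
  have "inv_into ?D (coding q) b = rosen_cf q b" if "b \<in> ?B" for b
    using inv_into_f_eq[OF bij_betw_imp_inj_on[OF bij] cf[OF that]] .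
  moreover have "coding q (dual_map q y) = seq_shift (coding q y)" if "y \<in> ?D" for y
    using coding_eq_digits[OF that] coding_eq_digits[OF dual_map_dom[OF that]]
    by (simp add: fun_eq_iff seq_shift_def digits_def funpow_swap1)
  ultimately show ?thesis
    using bij is_coding_iff dual_map_dom rosen_cf_converges rosen_cf_in_I_R by auto
qed

end
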